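(* If $X$ is a separable complex Banach space, then $X$ is $\mathbb C$-linearly isometric to a $1$-complemented subspace of the complex Banach space $\mathcal F_{\mathbb C}(X)$.
   Context: For a metric space $M$ with base point $0$, $\mathrm{Lip}_0(M)$ is the Banach space of Lipschitz functions $f\colon M\to\mathbb R$ with $f(0)=0$, normed by the least Lipschitz constant; $\delta\colon M\to \mathrm{Lip}_0(M)^*$ is given by $\langle f,\delta(m)\rangle=f(m)$; the (real) Lipschitz-free space is $\mathcal F(M)=\overline{\mathrm{span}}\,\delta(M)\subset \mathrm{Lip}_0(M)^*$. For a complex Banach space $X$ (base point $0$, with the unit circle acting by scalar multiplication), put $$Y_{\mathbb T}=\overline{\mathrm{span}}\{\delta(e^{i\theta}x)-\cos\theta\,\delta(x)-\sin\theta\,\delta(ix):\ x\in X,\ \theta\in\mathbb R\}\subseteq\mathcal F(X)$$ (real span), and let $\mathcal F_{\mathbb C}(X)=\mathcal F(X)/Y_{\mathbb T}$ with the quotient norm. It is a complex Banach space with multiplication by $i$ determined by $i.(\delta(x)+Y_{\mathbb T})=\delta(ix)+Y_{\mathbb T}$. A subspace is $1$-complemented if it is the range of a ($\mathbb C$-linear) projection of norm at most $1$. *)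

theory Defs
  imports "HOL-Analysis.Analysis"
begin

section \<open>Complex normed spaces\<close>

class complex_normed_vector = real_normed_vector +
  fixes scaleC :: "complex \<Rightarrow> 'a \<Rightarrow> 'a"  (infixr "*\<^sub>C" 75)
  assumes scaleC_add_right: "c *\<^sub>C (x + y) = c *\<^sub>C x + c *\<^sub>C y"
    and scaleC_add_left: "(c + d) *\<^sub>C x = c *\<^sub>C x + d *\<^sub>C x"
    and scaleC_scaleC: "c *\<^sub>C (d *\<^sub>C x) = (c * d) *\<^sub>C x"
    and scaleC_of_real: "of_real r *\<^sub>C x = r *\<^sub>R x"
    and norm_scaleC: "norm (c *\<^sub>C x) = cmod c * norm x"

class complex_banach = complex_normed_vector + complete_space

subclass (in complex_banach) banach ..

lemma scaleC_one: "1 *\<^sub>C x = (x :: 'a::complex_normed_vector)"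
  using scaleC_of_real[of 1 x] by simp

lemma vector_space_scaleC:
  "vector_space (scaleC :: complex \<Rightarrow> 'a::complex_normed_vector \<Rightarrow> 'a)"
  by unfold_locales (simp_all add: scaleC_add_right scaleC_add_left scaleC_scaleC scaleC_one)

lemma scaleC_zero_right [simp]: "c *\<^sub>C 0 = (0 :: 'a::complex_normed_vector)"
  using scaleC_add_right[of c "0::'a" 0] by simp

lemma scaleC_diff_right: "c *\<^sub>C (x - y) = c *\<^sub>C x - c *\<^sub>C (y :: 'a::complex_normed_vector)"
  using scaleC_add_right[of c "x - y" y] by (simp add: algebra_simps)

instantiation complex :: complex_banach
begin

definition scaleC_complex :: "complex \<Rightarrow> complex \<Rightarrow> complex" where
  "scaleC_complex c x = c * x"

instance
  by standard (simp_all add: scaleC_complex_def algebra_simps norm_mult scaleR_conv_of_real)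

end

abbreviation clinear :: "('a::complex_normed_vector \<Rightarrow> 'b::complex_normed_vector) \<Rightarrow> bool"
  where "clinear \<equiv> Vector_Spaces.linear scaleC scaleC"

definition one_complemented :: "'a::complex_normed_vector set \<Rightarrow> bool" where
  "one_complemented S \<longleftrightarrow>
    (\<exists>P. clinear P \<and> (\<forall>u. P (P u) = P u) \<and> (\<forall>u. norm (P u) \<le> norm u) \<and> range P = S)"


section \<open>Lipschitz functions vanishing at the base point\<close>

text \<open>The sort \<open>{metric_space, zero}\<close> is that of metric spaces with a base point, written \<open>0\<close>.\<close>

typedef (overloaded) 'a lip0 =
  "{f :: 'a::{metric_space, zero} \<Rightarrow> real. (\<exists>L. L-lipschitz_on UNIV f) \<and> f 0 = 0}"
  morphisms lip0_apply Lip0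
  by (rule exI[of _ "\<lambda>_. 0"]) (auto intro!: exI[of _ 0] lipschitz_onI)

setup_lifting type_definition_lip0

lemma lip0_apply_zero [simp]: "lip0_apply f 0 = 0"
  using lip0_apply[of f] by simp

lemma lip0_add_aux:
  fixes f g :: "'a::metric_space \<Rightarrow> real"
  assumes "L-lipschitz_on UNIV f" "M-lipschitz_on UNIV g"
  shows "(L + M)-lipschitz_on UNIV (\<lambda>x. f x + g x)"
  using assms by (rule lipschitz_on_add)

lemma lip0_scaleR_aux:
  fixes f :: "'a::metric_space \<Rightarrow> real"
  assumes "L-lipschitz_on UNIV f"
  shows "(\<bar>r\<bar> * L)-lipschitz_on UNIV (\<lambda>x. r * f x)"
  using lipschitz_on_cmult[OF assms, of r] by simp

instantiation lip0 :: ("{metric_space, zero}") real_normed_vector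
begin

lift_definition norm_lip0 :: "'a lip0 \<Rightarrow> real" is "\<lambda>f. Inf {L. L-lipschitz_on UNIV f}" .

lift_definition zero_lip0 :: "'a lip0" is "\<lambda>_. 0"
  by (auto intro!: exI[of _ 0] lipschitz_onI)

lift_definition plus_lip0 :: "'a lip0 \<Rightarrow> 'a lip0 \<Rightarrow> 'a lip0" is "\<lambda>f g x. f x + g x"
  by (auto intro: lip0_add_aux)

lift_definition scaleR_lip0 :: "real \<Rightarrow> 'a lip0 \<Rightarrow> 'a lip0" is "\<lambda>r f x. r * f x"
  by (auto intro: lip0_scaleR_aux)

lift_definition uminus_lip0 :: "'a lip0 \<Rightarrow> 'a lip0" is "\<lambda>f x. - f x"
  by (auto simp: lipschitz_on_minus)

lift_definition minus_lip0 :: "'a lip0 \<Rightarrow> 'a lip0 \<Rightarrow> 'a lip0" is "\<lambda>f g x. f x - g x"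
  by (auto intro: lipschitz_on_diff)

definition dist_lip0 :: "'a lip0 \<Rightarrow> 'a lip0 \<Rightarrow> real" where "dist_lip0 f g = norm (f - g)"

definition uniformity_lip0 :: "('a lip0 \<times> 'a lip0) filter" where
  "uniformity_lip0 = (INF e\<in>{0 <..}. principal {(x, y). dist x y < e})"

definition open_lip0 :: "'a lip0 set \<Rightarrow> bool" where
  "open_lip0 S = (\<forall>x\<in>S. \<forall>\<^sub>F (x', y) in uniformity. x' = x \<longrightarrow> y \<in> S)"

definition sgn_lip0 :: "'a lip0 \<Rightarrow> 'a lip0" where "sgn_lip0 x = scaleR (inverse (norm x)) x"

lemma norm_lip0_le: "L-lipschitz_on UNIV (lip0_apply f) \<Longrightarrow> norm f \<le> L"
  unfolding norm_lip0.rep_eq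
  by (rule cInf_lower) (auto intro!: bdd_belowI[of _ 0] lipschitz_on_nonneg)

lemma lip0_lipschitz: "(norm f)-lipschitz_on UNIV (lip0_apply f)"
proof -
  let ?A = "{L. L-lipschitz_on UNIV (lip0_apply f)}"
  have ne: "?A \<noteq> {}" using lip0_apply[of f] by auto
  have n: "norm f = Inf ?A" by (simp add: norm_lip0.rep_eq)
  have 0: "0 \<le> norm f"
    unfolding n using ne by (intro cInf_greatest) (auto intro: lipschitz_on_nonneg)
  show ?thesis
  proof (rule lipschitz_onI[OF _ 0])
    fix x y :: 'a
    show "dist (lip0_apply f x) (lip0_apply f y) \<le> norm f * dist x y"
    proof (cases "x = y")
      case False
      then have p: "0 < dist x y" by simp
      have "dist (lip0_apply f x) (lip0_apply f y) / dist x y \<le> Inf ?A"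
        using ne
      proof (rule cInf_greatest)
        fix L assume "L \<in> ?A"
        then show "dist (lip0_apply f x) (lip0_apply f y) / dist x y \<le> L"
          using p by (auto simp: divide_le_eq dest: lipschitz_onD)
      qed
      then show ?thesis using p by (simp add: n divide_le_eq)
    qed simp
  qed
qed

instance
proof
  fix f g h :: "'a lip0" and r s :: real
  show "f + g + h = f + (g + h)" by transfer (simp add: algebra_simps)
  show "f + g = g + f" by transfer (simp add: algebra_simps)
  show "0 + f = f" by transfer simp
  show "- f + f = 0" by transfer simp
  show "f - g = f + - g" by transfer simp
  show "r *\<^sub>R (f + g) = r *\<^sub>R f + r *\<^sub>R g" by transfer (simp add: algebra_simps)
  show "(r + s) *\<^sub>R f = r *\<^sub>R f + s *\<^sub>R f" by transfer (simp add: algebra_simps)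
  show "r *\<^sub>R s *\<^sub>R f = (r * s) *\<^sub>R f" by transfer (simp add: algebra_simps)
  show "1 *\<^sub>R f = f" by transfer simp
  show "dist f g = norm (f - g)" by (rule dist_lip0_def)
  show "sgn f = inverse (norm f) *\<^sub>R f" by (rule sgn_lip0_def)
  show "(uniformity :: ('a lip0 \<times> 'a lip0) filter) = (INF e\<in>{0 <..}. principal {(x, y). dist x y < e})"
    by (rule uniformity_lip0_def)
  show "open U = (\<forall>x\<in>U. \<forall>\<^sub>F (x', y) in uniformity. x' = x \<longrightarrow> y \<in> U)" for U :: "'a lip0 set"
    by (rule open_lip0_def)
  show "norm f = 0 \<longleftrightarrow> f = 0"
  proof
    assume "norm f = 0"
    then have "lip0_apply f x = 0" for x
      using lipschitz_onD[OF lip0_lipschitz[of f], of x 0] by simp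
    then show "f = 0" by transfer auto
  next
    assume "f = 0"
    then have "0-lipschitz_on UNIV (lip0_apply f)"
      by (auto simp: zero_lip0.rep_eq intro!: lipschitz_onI)
    then have "norm f \<le> 0" by (rule norm_lip0_le)
    then show "norm f = 0" using lipschitz_on_nonneg[OF lip0_lipschitz[of f]] by simp
  qed
  show "norm (f + g) \<le> norm f + norm g"
    by (rule norm_lip0_le) (simp add: plus_lip0.rep_eq lip0_add_aux lip0_lipschitz)
  have le: "norm (r *\<^sub>R f) \<le> \<bar>r\<bar> * norm f" for r :: real and f :: "'a lip0"
    by (rule norm_lip0_le) (simp add: scaleR_lip0.rep_eq lip0_scaleR_aux lip0_lipschitz)
  show "norm (r *\<^sub>R f) = \<bar>r\<bar> * norm f"
  proof (cases "r = 0")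
    case True
    then show ?thesis
      using le[of 0 f] lipschitz_on_nonneg[OF lip0_lipschitz[of "0 *\<^sub>R f"]] by simp
  next
    case False
    have "inverse r *\<^sub>R r *\<^sub>R f = f" using False by transfer (auto simp: field_simps)
    then have "norm f \<le> \<bar>inverse r\<bar> * norm (r *\<^sub>R f)" using le[of "inverse r" "r *\<^sub>R f"] by simp
    then have "\<bar>r\<bar> * norm f \<le> norm (r *\<^sub>R f)" using False by (simp add: field_simps)
    with le[of r f] show ?thesis by simp
  qed
qed

end


section \<open>The real Lipschitz-free space\<close>

lemma closure_subspace:
  fixes S :: "'a::real_normed_vector set"
  assumes S: "subspace S" shows "subspace (closure S)"
  unfolding subspace_def
proof (intro conjI ballI allI)
  show "0 \<in> closure S" using subspace_0[OF S] closure_subset by blast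
  fix x assume "x \<in> closure S"
  then obtain f where f: "\<And>n. f n \<in> S" "f \<longlonglongrightarrow> x" by (auto simp: closure_sequential)
  show "c *\<^sub>R x \<in> closure S" for c
    unfolding closure_sequential using f
    by (intro exI[of _ "\<lambda>n. c *\<^sub>R f n"]) (auto intro: subspace_scale[OF S] tendsto_intros)
  fix y assume "y \<in> closure S"
  then obtain g where g: "\<And>n. g n \<in> S" "g \<longlonglongrightarrow> y" by (auto simp: closure_sequential)
  show "x + y \<in> closure S"
    unfolding closure_sequential using f g
    by (intro exI[of _ "\<lambda>n. f n + g n"]) (auto intro: subspace_add[OF S] tendsto_intros)
qed

lift_definition eval_lip0 :: "'a::{metric_space, zero} \<Rightarrow> ('a lip0 \<Rightarrow>\<^sub>L real)" is "\<lambda>x f. lip0_apply f x"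
proof (rule bounded_linear_intro)
  fix x :: 'a and f g :: "'a lip0" and r :: real
  show "lip0_apply (f + g) x = lip0_apply f x + lip0_apply g x" by (simp add: plus_lip0.rep_eq)
  show "lip0_apply (r *\<^sub>R f) x = r *\<^sub>R lip0_apply f x" by (simp add: scaleR_lip0.rep_eq)
  show "norm (lip0_apply f x) \<le> norm f * dist x 0"
    using lipschitz_onD[OF lip0_lipschitz[of f], of x 0] by simp
qed

typedef (overloaded) 'a lipfree =
  "closure (span (range (eval_lip0 :: 'a::{metric_space, zero} \<Rightarrow> _)))"
  morphisms lipfree_functional Lipfree
  using span_zero closure_subset by blast

setup_lifting type_definition_lipfree

lemma subspace_lipfree_functionals: "subspace (closure (span (range eval_lip0)))"
  by (rule closure_subspace) (rule subspace_span)

instantiation lipfree :: ("{metric_space, zero}") real_normed_vector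
begin

lift_definition norm_lipfree :: "'a lipfree \<Rightarrow> real" is norm .

lift_definition zero_lipfree :: "'a lipfree" is 0
  by (rule subspace_0[OF subspace_lipfree_functionals])

lift_definition plus_lipfree :: "'a lipfree \<Rightarrow> 'a lipfree \<Rightarrow> 'a lipfree" is "(+)"
  by (rule subspace_add[OF subspace_lipfree_functionals])

lift_definition scaleR_lipfree :: "real \<Rightarrow> 'a lipfree \<Rightarrow> 'a lipfree" is scaleR
  by (rule subspace_scale[OF subspace_lipfree_functionals])

lift_definition uminus_lipfree :: "'a lipfree \<Rightarrow> 'a lipfree" is uminus
  by (rule subspace_neg[OF subspace_lipfree_functionals])

lift_definition minus_lipfree :: "'a lipfree \<Rightarrow> 'a lipfree \<Rightarrow> 'a lipfree" is minus
  by (rule subspace_diff[OF subspace_lipfree_functionals])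

lift_definition dist_lipfree :: "'a lipfree \<Rightarrow> 'a lipfree \<Rightarrow> real" is dist .

definition uniformity_lipfree :: "('a lipfree \<times> 'a lipfree) filter" where
  "uniformity_lipfree = (INF e\<in>{0 <..}. principal {(x, y). dist x y < e})"

definition open_lipfree :: "'a lipfree set \<Rightarrow> bool" where
  "open_lipfree S = (\<forall>x\<in>S. \<forall>\<^sub>F (x', y) in uniformity. x' = x \<longrightarrow> y \<in> S)"

definition sgn_lipfree :: "'a lipfree \<Rightarrow> 'a lipfree" where
  "sgn_lipfree x = scaleR (inverse (norm x)) x"

instance
proof
  fix f g h :: "'a lipfree" and r s :: real
  show "f + g + h = f + (g + h)" by transfer (simp add: algebra_simps)
  show "f + g = g + f" by transfer (simp add: algebra_simps)
  show "0 + f = f" by transfer simp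
  show "- f + f = 0" by transfer simp
  show "f - g = f + - g" by transfer simp
  show "r *\<^sub>R (f + g) = r *\<^sub>R f + r *\<^sub>R g" by transfer (simp add: algebra_simps)
  show "(r + s) *\<^sub>R f = r *\<^sub>R f + s *\<^sub>R f" by transfer (simp add: algebra_simps)
  show "r *\<^sub>R s *\<^sub>R f = (r * s) *\<^sub>R f" by transfer simp
  show "1 *\<^sub>R f = f" by transfer simp
  show "dist f g = norm (f - g)" by transfer (rule dist_norm)
  show "sgn f = inverse (norm f) *\<^sub>R f" by (rule sgn_lipfree_def)
  show "(uniformity :: ('a lipfree \<times> 'a lipfree) filter) =
      (INF e\<in>{0 <..}. principal {(x, y). dist x y < e})"
    by (rule uniformity_lipfree_def)
  show "open U = (\<forall>x\<in>U. \<forall>\<^sub>F (x', y) in uniformity. x' = x \<longrightarrow> y \<in> U)" for U :: "'a lipfree set"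
    by (rule open_lipfree_def)
  show "norm f = 0 \<longleftrightarrow> f = 0" by transfer simp
  show "norm (f + g) \<le> norm f + norm g" by transfer (rule norm_triangle_ineq)
  show "norm (r *\<^sub>R f) = \<bar>r\<bar> * norm f" by transfer simp
qed

end

instance lipfree :: ("{metric_space, zero}") banach
proof
  fix X :: "nat \<Rightarrow> 'a lipfree"
  assume "Cauchy X"
  then have "Cauchy (\<lambda>n. lipfree_functional (X n))"
    by (simp add: Cauchy_def dist_lipfree.rep_eq)
  then obtain \<phi> where \<phi>: "(\<lambda>n. lipfree_functional (X n)) \<longlonglongrightarrow> \<phi>"
    using Cauchy_convergent_iff convergent_def by blast
  moreover have "\<phi> \<in> closure (span (range (eval_lip0 :: 'a \<Rightarrow> _)))"
    by (rule closed_sequentially[OF closed_closure _ \<phi>]) (rule lipfree_functional)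
  then have "lipfree_functional (Lipfree \<phi>) = \<phi>" by (rule Lipfree_inverse)
  ultimately have "X \<longlonglongrightarrow> Lipfree \<phi>"
    by (simp add: lim_sequentially dist_lipfree.rep_eq)
  then show "convergent X" by (auto simp: convergent_def)
qed

lift_definition \<delta> :: "'a::{metric_space, zero} \<Rightarrow> 'a lipfree" is eval_lip0
  by (rule subsetD[OF closure_subset], rule span_base) simp

lemma linear_lipfree_functional: "linear lipfree_functional"
  by (rule linearI) (simp_all add: plus_lipfree.rep_eq scaleR_lipfree.rep_eq)

lemma closure_span_delta: "closure (span (range (\<delta> :: 'a::{metric_space, zero} \<Rightarrow> _))) = UNIV"
proof -
  have "u \<in> closure (span (range \<delta>))" for u :: "'a lipfree"
    unfolding closure_approachable
  proof (intro allI impI)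
    fix e :: real assume e: "0 < e"
    obtain w where w: "w \<in> span (range (eval_lip0 :: 'a \<Rightarrow> _))" "dist w (lipfree_functional u) < e"
      using lipfree_functional[of u] e unfolding closure_approachable by blast
    have "range (eval_lip0 :: 'a \<Rightarrow> _) = lipfree_functional ` range \<delta>"
      by (simp add: image_image \<delta>.rep_eq)
    then have "w \<in> lipfree_functional ` span (range \<delta>)"
      using w(1) linear_span_image[OF linear_lipfree_functional, of "range \<delta>"] by metis
    with w(2) show "\<exists>y\<in>span (range \<delta>). dist y u < e"
      by (auto simp: dist_lipfree.rep_eq)
  qed
  then show ?thesis by blast
qed

lemma lipfree_induct:
  fixes T :: "'a::{metric_space, zero} lipfree \<Rightarrow> 'b::real_normed_vector"
  assumes T: "bounded_linear T" and S: "subspace S" "closed S" and gen: "\<And>x. T (\<delta> x) \<in> S"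
  shows "T u \<in> S"
proof -
  have "closed (T -` S)"
    using S(2) T by (intro closed_vimage) (auto intro: bounded_linear.continuous_on[OF _ continuous_on_id])
  moreover have "subspace (T -` S)"
    using linear_subspace_vimage[OF bounded_linear.linear[OF T] S(1)] by simp
  then have "span (range \<delta>) \<subseteq> T -` S" using gen by (intro span_minimal) auto
  ultimately have "closure (span (range \<delta>)) \<subseteq> T -` S" by (rule closure_minimal[rotated])
  then show ?thesis by (auto simp: closure_span_delta)
qed


section \<open>The complex Lipschitz-free space\<close>

lift_definition lip0_dilate :: "complex \<Rightarrow> 'a::complex_normed_vector lip0 \<Rightarrow> 'a lip0"
  is "\<lambda>c f x. f (c *\<^sub>C x)"
proof safe
  fix c :: complex and f :: "'a \<Rightarrow> real" and L
  assume "f 0 = 0" then show "f (c *\<^sub>C 0) = 0" by simp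
  assume L: "L-lipschitz_on UNIV f"
  show "\<exists>L. L-lipschitz_on UNIV (\<lambda>x. f (c *\<^sub>C x))"
  proof (intro exI lipschitz_onI)
    show "dist (f (c *\<^sub>C x)) (f (c *\<^sub>C y)) \<le> (L * cmod c) * dist x y" for x y
      using lipschitz_onD[OF L, of "c *\<^sub>C x" "c *\<^sub>C y"]
      by (simp add: dist_norm norm_scaleC scaleC_diff_right[symmetric] mult.assoc)
    show "0 \<le> L * cmod c" using lipschitz_on_nonneg[OF L] by simp
  qed
qed

lemma norm_lip0_dilate: "norm (lip0_dilate c f) \<le> norm f * cmod c"
proof (intro norm_lip0_le lipschitz_onI)
  show "dist (lip0_apply (lip0_dilate c f) x) (lip0_apply (lip0_dilate c f) y) \<le> (norm f * cmod c) * dist x y" for x y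
    using lipschitz_onD[OF lip0_lipschitz[of f], of "c *\<^sub>C x" "c *\<^sub>C y"]
    by (simp add: lip0_dilate.rep_eq dist_norm norm_scaleC scaleC_diff_right[symmetric] mult.assoc)
qed simp

lemma bounded_linear_lip0_dilate: "bounded_linear (lip0_dilate c)"
proof (rule bounded_linear_intro)
  show "lip0_dilate c (f + g) = lip0_dilate c f + lip0_dilate c g" for f g :: "'a lip0"
    by transfer simp
  show "lip0_dilate c (r *\<^sub>R f) = r *\<^sub>R lip0_dilate c f" for r and f :: "'a lip0"
    by transfer simp
  show "norm (lip0_dilate c f) \<le> norm f * cmod c" for f :: "'a lip0"
    by (rule norm_lip0_dilate)
qed

lemma eval_lip0_dilate:
  "eval_lip0 x o\<^sub>L Blinfun (lip0_dilate c) = eval_lip0 (c *\<^sub>C x)"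
  by (rule blinfun_eqI)
    (simp add: bounded_linear_Blinfun_apply[OF bounded_linear_lip0_dilate] eval_lip0.rep_eq lip0_dilate.rep_eq)

text \<open>The linearization of \<open>x \<mapsto> c x\<close>, that is, the restriction to the free space of the adjoint
  of \<open>f \<mapsto> f(c \<cdot>)\<close>; it sends \<open>\<delta> x\<close> to \<open>\<delta> (c x)\<close>.\<close>

lift_definition lipfree_dilate :: "complex \<Rightarrow> 'a::complex_normed_vector lipfree \<Rightarrow> 'a lipfree"
  is "\<lambda>c \<phi>. \<phi> o\<^sub>L Blinfun (lip0_dilate c)"
proof -
  fix c :: complex and \<phi> :: "'a lip0 \<Rightarrow>\<^sub>L real"
  let ?T = "\<lambda>\<phi> :: 'a lip0 \<Rightarrow>\<^sub>L real. \<phi> o\<^sub>L Blinfun (lip0_dilate c)"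
  let ?D = "range (eval_lip0 :: 'a \<Rightarrow> _)"
  assume \<phi>: "\<phi> \<in> closure (span ?D)"
  have bl: "bounded_linear ?T" 
    by (rule bounded_bilinear.bounded_linear_left[OF bounded_bilinear_blinfun_compose])
  have "?T ` span ?D = span (?T ` ?D)"
    using bl by (simp add: linear_span_image bounded_linear.linear)
  also have "\<dots> \<subseteq> span ?D" by (rule span_mono) (auto simp: eval_lip0_dilate)
  finally have "?T ` span ?D \<subseteq> closure (span ?D)" using closure_subset by blast
  then have "?T ` closure (span ?D) \<subseteq> closure (span ?D)"
    using bl by (intro image_closure_subset) (auto intro: bounded_linear.continuous_on[OF _ continuous_on_id])
  with \<phi> show "?T \<phi> \<in> closure (span ?D)" by blast
qed

lemma lipfree_dilate_delta [simp]: "lipfree_dilate c (\<delta> x) = \<delta> (c *\<^sub>C x)"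
  by transfer (rule eval_lip0_dilate)

lemma norm_lipfree_dilate: "norm (lipfree_dilate c u) \<le> norm u * cmod c"
proof transfer
  fix c and \<phi> :: "'a lip0 \<Rightarrow>\<^sub>L real"
  have "norm (Blinfun (lip0_dilate c) :: 'a lip0 \<Rightarrow>\<^sub>L _) \<le> cmod c"
    by (rule norm_blinfun_bound)
      (simp_all add: bounded_linear_Blinfun_apply[OF bounded_linear_lip0_dilate] norm_lip0_dilate mult.commute)
  then show "norm (\<phi> o\<^sub>L Blinfun (lip0_dilate c)) \<le> norm \<phi> * cmod c"
    by (meson norm_blinfun_compose order_trans mult_left_mono norm_ge_zero)
qed

lemma bounded_linear_lipfree_dilate: "bounded_linear (lipfree_dilate c)"
proof (rule bounded_linear_intro)
  show "lipfree_dilate c (u + v) = lipfree_dilate c u + lipfree_dilate c v" for u v :: "'a lipfree"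
    by transfer (rule bounded_bilinear.add_left[OF bounded_bilinear_blinfun_compose])
  show "lipfree_dilate c (r *\<^sub>R u) = r *\<^sub>R lipfree_dilate c u" for r and u :: "'a lipfree"
    by transfer (rule bounded_bilinear.scaleR_left[OF bounded_bilinear_blinfun_compose])
  show "norm (lipfree_dilate c u) \<le> norm u * cmod c" for u :: "'a lipfree"
    by (rule norm_lipfree_dilate)
qed

lemmas lipfree_dilate_linear =
  linear_add[OF bounded_linear.linear[OF bounded_linear_lipfree_dilate]]
  linear_diff[OF bounded_linear.linear[OF bounded_linear_lipfree_dilate]]
  linear_scale[OF bounded_linear.linear[OF bounded_linear_lipfree_dilate]]

definition Y_T :: "'a::complex_normed_vector lipfree set" where
  "Y_T = closure (span {\<delta> (cis \<theta> *\<^sub>C x) - cos \<theta> *\<^sub>R \<delta> x - sin \<theta> *\<^sub>R \<delta> (\<i> *\<^sub>C x) | x \<theta>. True})"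

lemma subspace_Y_T: "subspace Y_T" and closed_Y_T: "closed Y_T"
  by (simp_all add: Y_T_def closure_subspace)

lemma Y_T_nonempty: "Y_T \<noteq> {}"
  using subspace_0[OF subspace_Y_T] by blast

lemma Y_T_gen: "\<delta> (cis \<theta> *\<^sub>C x) - cos \<theta> *\<^sub>R \<delta> x - sin \<theta> *\<^sub>R \<delta> (\<i> *\<^sub>C x) \<in> Y_T"
  unfolding Y_T_def by (rule subsetD[OF closure_subset], rule span_base) blast

lemma lipfree_dilate_Y_T:
  assumes "u \<in> Y_T" shows "lipfree_dilate c u \<in> Y_T"
proof -
  let ?G = "{\<delta> (cis \<theta> *\<^sub>C x) - cos \<theta> *\<^sub>R \<delta> x - sin \<theta> *\<^sub>R \<delta> (\<i> *\<^sub>C x) | (x::'a) \<theta>. True}"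
  have "lipfree_dilate c ` ?G \<subseteq> Y_T"
  proof safe
    fix x :: 'a and \<theta>
    show "lipfree_dilate c (\<delta> (cis \<theta> *\<^sub>C x) - cos \<theta> *\<^sub>R \<delta> x - sin \<theta> *\<^sub>R \<delta> (\<i> *\<^sub>C x)) \<in> Y_T"
      using Y_T_gen[of \<theta> "c *\<^sub>C x"]
      by (simp add: lipfree_dilate_linear scaleC_scaleC mult.commute)
  qed
  then have "span (lipfree_dilate c ` ?G) \<subseteq> Y_T" by (rule span_minimal[OF _ subspace_Y_T])
  then have "lipfree_dilate c ` span ?G \<subseteq> Y_T"
    by (simp add: linear_span_image[OF bounded_linear.linear[OF bounded_linear_lipfree_dilate]])
  then have "lipfree_dilate c ` closure (span ?G) \<subseteq> Y_T"
    by (intro image_closure_subset closed_Y_T)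
      (auto intro: bounded_linear.continuous_on[OF bounded_linear_lipfree_dilate continuous_on_id])
  with assms show ?thesis by (auto simp: Y_T_def)
qed

lemma lipfree_dilate_cis:
  "lipfree_dilate (cis \<theta>) u - cos \<theta> *\<^sub>R u - sin \<theta> *\<^sub>R lipfree_dilate \<i> u \<in> Y_T"
  by (rule lipfree_induct[OF _ subspace_Y_T closed_Y_T])
    (auto intro!: Y_T_gen bounded_linear_sub bounded_linear_lipfree_dilate
      bounded_linear_const_scaleR bounded_linear_ident)

lemma lipfree_dilate_ii: "lipfree_dilate \<i> (lipfree_dilate \<i> u) + u \<in> Y_T"
proof (rule lipfree_induct[where T = "\<lambda>u. lipfree_dilate \<i> (lipfree_dilate \<i> u) + u",
      OF _ subspace_Y_T closed_Y_T])
  show "bounded_linear (\<lambda>u. lipfree_dilate \<i> (lipfree_dilate \<i> u) + (u :: 'a lipfree))"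
    by (intro bounded_linear_add bounded_linear_ident
        bounded_linear_compose[OF bounded_linear_lipfree_dilate bounded_linear_lipfree_dilate])
  show "lipfree_dilate \<i> (lipfree_dilate \<i> (\<delta> x)) + \<delta> x \<in> Y_T" for x :: 'a
    using Y_T_gen[of pi x] by (simp add: scaleC_scaleC)
qed

quotient_type (overloaded) 'a clipfree = "'a::complex_normed_vector lipfree" / "\<lambda>u v. u - v \<in> Y_T"
  morphisms clipfree_rep clipfree_class
proof (rule equivpI)
  show "reflp (\<lambda>u v :: 'a lipfree. u - v \<in> Y_T)"
    by (simp add: reflp_def subspace_0[OF subspace_Y_T])
  show "symp (\<lambda>u v :: 'a lipfree. u - v \<in> Y_T)"
    using subspace_neg[OF subspace_Y_T] by (metis (no_types, lifting) sympI minus_diff_eq)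
  show "transp (\<lambda>u v :: 'a lipfree. u - v \<in> Y_T)"
  proof (rule transpI)
    fix u v w :: "'a lipfree"
    assume "u - v \<in> Y_T" "v - w \<in> Y_T"
    from subspace_add[OF subspace_Y_T this] show "u - w \<in> Y_T" by simp
  qed
qed

lemma infdist_Y_T_le: "y \<in> Y_T \<Longrightarrow> infdist u Y_T \<le> norm (u - y)"
  using infdist_le[of y Y_T u] by (simp add: dist_norm)

lemma infdist_Y_T_approx:
  assumes "0 < e" shows "\<exists>y\<in>Y_T. norm (u - y) < infdist u Y_T + e"
proof -
  have "(INF y\<in>Y_T. dist u y) < infdist u Y_T + e"
    using assms by (simp add: infdist_notempty[OF Y_T_nonempty])
  then have "\<exists>d\<in>dist u ` Y_T. d < infdist u Y_T + e"
    using Y_T_nonempty by (intro cInf_lessD) simp_all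
  then show ?thesis by (auto simp: dist_norm)
qed

lemma infdist_Y_T_cong:
  assumes "u - v \<in> Y_T" shows "infdist u Y_T = infdist v Y_T"
proof -
  have le: "infdist u Y_T \<le> infdist v Y_T" if "u - v \<in> Y_T" for u v :: "'a lipfree"
  proof (rule field_le_epsilon)
    fix e :: real assume "0 < e"
    then obtain y where y: "y \<in> Y_T" "norm (v - y) < infdist v Y_T + e"
      using infdist_Y_T_approx by blast
    have "infdist u Y_T \<le> norm (u - ((u - v) + y))"
      using that y(1) by (intro infdist_Y_T_le subspace_add[OF subspace_Y_T])
    also have "u - ((u - v) + y) = v - y" by simp
    finally show "infdist u Y_T \<le> infdist v Y_T + e" using y(2) by linarith
  qed
  have "v - u \<in> Y_T" using subspace_neg[OF subspace_Y_T assms] by simp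
  with assms show ?thesis by (intro antisym le)
qed

lemma infdist_Y_T_contraction:
  assumes T: "linear T" "\<And>y. y \<in> Y_T \<Longrightarrow> T y \<in> Y_T" and K: "\<And>v. norm (T v) \<le> K * norm v" "0 \<le> K"
  shows "infdist (T u) Y_T \<le> K * infdist u Y_T"
proof (rule field_le_epsilon)
  fix e :: real assume e: "0 < e"
  then have "0 < e / (K + 1)" using K(2) by simp
  then obtain y where y: "y \<in> Y_T" "norm (u - y) < infdist u Y_T + e / (K + 1)"
    using infdist_Y_T_approx by blast
  have "infdist (T u) Y_T \<le> norm (T u - T y)" using T(2) y(1) by (intro infdist_Y_T_le)
  also have "\<dots> = norm (T (u - y))" using T(1) by (simp add: linear_diff)
  also have "\<dots> \<le> K * norm (u - y)" by (rule K)
  also have "\<dots> \<le> K * (infdist u Y_T + e / (K + 1))"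
    using y(2) K(2) by (intro mult_left_mono) auto
  also have "\<dots> \<le> K * infdist u Y_T + e"
    using e K(2) by (simp add: field_simps)
  finally show "infdist (T u) Y_T \<le> K * infdist u Y_T + e" .
qed

text \<open>The quotient norm of the class of \<open>u\<close> is \<open>infdist u Y_T\<close>, the infimum of \<open>norm (u - y)\<close>
  over \<open>y\<close> in \<open>Y_T\<close>.\<close>

instantiation clipfree :: (complex_normed_vector) real_normed_vector
begin

lift_definition norm_clipfree :: "'a clipfree \<Rightarrow> real" is "\<lambda>u. infdist u Y_T"
  by (rule infdist_Y_T_cong)

lift_definition zero_clipfree :: "'a clipfree" is 0 .

lift_definition plus_clipfree :: "'a clipfree \<Rightarrow> 'a clipfree \<Rightarrow> 'a clipfree" is "(+)"
  by (subst add_diff_add) (rule subspace_add[OF subspace_Y_T])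

lift_definition scaleR_clipfree :: "real \<Rightarrow> 'a clipfree \<Rightarrow> 'a clipfree" is scaleR
  by (subst scaleR_right_diff_distrib[symmetric]) (rule subspace_scale[OF subspace_Y_T])

lift_definition uminus_clipfree :: "'a clipfree \<Rightarrow> 'a clipfree" is uminus
  by (subst minus_diff_minus) (rule subspace_neg[OF subspace_Y_T])

lift_definition minus_clipfree :: "'a clipfree \<Rightarrow> 'a clipfree \<Rightarrow> 'a clipfree" is minus
proof -
  fix u u' v v' :: "'a lipfree"
  assume "u - u' \<in> Y_T" "v - v' \<in> Y_T"
  from subspace_diff[OF subspace_Y_T this] show "u - v - (u' - v') \<in> Y_T"
    by (simp add: algebra_simps)
qed

definition dist_clipfree :: "'a clipfree \<Rightarrow> 'a clipfree \<Rightarrow> real" where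
  "dist_clipfree u v = norm (u - v)"

definition uniformity_clipfree :: "('a clipfree \<times> 'a clipfree) filter" where
  "uniformity_clipfree = (INF e\<in>{0 <..}. principal {(x, y). dist x y < e})"

definition open_clipfree :: "'a clipfree set \<Rightarrow> bool" where
  "open_clipfree S = (\<forall>x\<in>S. \<forall>\<^sub>F (x', y) in uniformity. x' = x \<longrightarrow> y \<in> S)"

definition sgn_clipfree :: "'a clipfree \<Rightarrow> 'a clipfree" where
  "sgn_clipfree x = scaleR (inverse (norm x)) x"

instance
proof
  fix f g h :: "'a clipfree" and r s :: real
  note zero = subspace_0[OF subspace_Y_T]
  show "f + g + h = f + (g + h)" by transfer (simp add: zero algebra_simps)
  show "f + g = g + f" by transfer (simp add: zero algebra_simps)
  show "0 + f = f" by transfer (simp add: zero)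
  show "- f + f = 0" by transfer (simp add: zero)
  show "f - g = f + - g" by transfer (simp add: zero)
  show "r *\<^sub>R (f + g) = r *\<^sub>R f + r *\<^sub>R g" by transfer (simp add: zero algebra_simps)
  show "(r + s) *\<^sub>R f = r *\<^sub>R f + s *\<^sub>R f" by transfer (simp add: zero algebra_simps)
  show "r *\<^sub>R s *\<^sub>R f = (r * s) *\<^sub>R f" by transfer (simp add: zero)
  show "1 *\<^sub>R f = f" by transfer (simp add: zero)
  show "dist f g = norm (f - g)" by (rule dist_clipfree_def)
  show "sgn f = inverse (norm f) *\<^sub>R f" by (rule sgn_clipfree_def)
  show "(uniformity :: ('a clipfree \<times> 'a clipfree) filter) =
      (INF e\<in>{0 <..}. principal {(x, y). dist x y < e})"
    by (rule uniformity_clipfree_def)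
  show "open U = (\<forall>x\<in>U. \<forall>\<^sub>F (x', y) in uniformity. x' = x \<longrightarrow> y \<in> U)" for U :: "'a clipfree set"
    by (rule open_clipfree_def)
  show "norm f = 0 \<longleftrightarrow> f = 0"
    by transfer (simp add: in_closed_iff_infdist_zero[OF closed_Y_T Y_T_nonempty, symmetric])
  show "norm (f + g) \<le> norm f + norm g"
  proof transfer
    fix u v :: "'a lipfree"
    show "infdist (u + v) Y_T \<le> infdist u Y_T + infdist v Y_T"
    proof (rule field_le_epsilon)
      fix e :: real assume "0 < e"
      then have "0 < e / 2" by simp
      then obtain y z where y: "y \<in> Y_T" "norm (u - y) < infdist u Y_T + e / 2"
        and z: "z \<in> Y_T" "norm (v - z) < infdist v Y_T + e / 2"
        using infdist_Y_T_approx by metis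
      have "infdist (u + v) Y_T \<le> norm (u + v - (y + z))"
        using y(1) z(1) by (intro infdist_Y_T_le subspace_add[OF subspace_Y_T])
      also have "\<dots> \<le> norm (u - y) + norm (v - z)"
        using norm_triangle_ineq[of "u - y" "v - z"] by (simp add: algebra_simps)
      finally show "infdist (u + v) Y_T \<le> infdist u Y_T + infdist v Y_T + e" using y(2) z(2) by simp
    qed
  qed
  have le: "norm (r *\<^sub>R f) \<le> \<bar>r\<bar> * norm f" for r :: real and f :: "'a clipfree"
    by transfer (rule infdist_Y_T_contraction, auto intro: linear_scaleR subspace_scale[OF subspace_Y_T])
  show "norm (r *\<^sub>R f) = \<bar>r\<bar> * norm f"
  proof (cases "r = 0")
    case True
    have "0 \<le> norm (r *\<^sub>R f)" by transfer (rule infdist_nonneg)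
    with True show ?thesis using le[of r f] by simp
  next
    case False
    have "inverse r *\<^sub>R r *\<^sub>R f = f" using False by transfer (simp add: zero)
    then have "norm f \<le> \<bar>inverse r\<bar> * norm (r *\<^sub>R f)" using le[of "inverse r" "r *\<^sub>R f"] by simp
    then have "\<bar>r\<bar> * norm f \<le> norm (r *\<^sub>R f)" using False by (simp add: field_simps)
    with le[of r f] show ?thesis by simp
  qed
qed

end

lift_definition clipfree_dilate :: "complex \<Rightarrow> 'a::complex_normed_vector clipfree \<Rightarrow> 'a clipfree"
  is lipfree_dilate
  by (subst lipfree_dilate_linear(2)[symmetric]) (rule lipfree_dilate_Y_T)

lemma clipfree_dilate_cis: "clipfree_dilate (cis \<theta>) u = cos \<theta> *\<^sub>R u + sin \<theta> *\<^sub>R clipfree_dilate \<i> u"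
  by transfer (use lipfree_dilate_cis in \<open>simp add: algebra_simps\<close>)

lemma clipfree_dilate_ii: "clipfree_dilate \<i> (clipfree_dilate \<i> u) = - u"
  by transfer (simp add: lipfree_dilate_ii)

lemma clipfree_dilate_linear:
  "clipfree_dilate c (u + v) = clipfree_dilate c u + clipfree_dilate c v"
  "clipfree_dilate c (r *\<^sub>R u) = r *\<^sub>R clipfree_dilate c u"
  by (transfer, simp add: lipfree_dilate_linear subspace_0[OF subspace_Y_T])+

lemma norm_clipfree_dilate: "norm (clipfree_dilate c u) \<le> cmod c * norm u"
  by transfer
    (rule infdist_Y_T_contraction, auto intro: bounded_linear.linear bounded_linear_lipfree_dilate
      lipfree_dilate_Y_T simp: norm_lipfree_dilate mult.commute)

text \<open>Multiplication by \<open>\<i>\<close> on the quotient is induced by \<open>\<delta> x \<mapsto> \<delta> (\<i> x)\<close>; see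
  \<open>scaleC_ii_clipfree_class\<close> below. For general \<open>c\<close> the map \<open>clipfree_dilate c\<close> is not
  multiplication by \<open>c\<close>.\<close>

instantiation clipfree :: (complex_normed_vector) complex_normed_vector
begin

definition scaleC_clipfree :: "complex \<Rightarrow> 'a clipfree \<Rightarrow> 'a clipfree" where
  "scaleC_clipfree c u = Re c *\<^sub>R u + Im c *\<^sub>R clipfree_dilate \<i> u"

instance
proof
  fix c d :: complex and u v :: "'a clipfree" and r :: real
  show "c *\<^sub>C (u + v) = c *\<^sub>C u + c *\<^sub>C v"
    by (simp add: scaleC_clipfree_def clipfree_dilate_linear algebra_simps)
  show "(c + d) *\<^sub>C u = c *\<^sub>C u + d *\<^sub>C u"
    by (simp add: scaleC_clipfree_def algebra_simps)
  have assoc: "c *\<^sub>C (d *\<^sub>C u) = (c * d) *\<^sub>C u" for c d and u :: "'a clipfree"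
    by (simp add: scaleC_clipfree_def clipfree_dilate_linear clipfree_dilate_ii algebra_simps)
  then show "c *\<^sub>C (d *\<^sub>C u) = (c * d) *\<^sub>C u" .
  show "complex_of_real r *\<^sub>C u = r *\<^sub>R u"
    by (simp add: scaleC_clipfree_def)
  have le: "norm (c *\<^sub>C u) \<le> cmod c * norm u" for c and u :: "'a clipfree"
  proof -
    have "c *\<^sub>C u = cmod c *\<^sub>R clipfree_dilate (cis (Arg c)) u"
      using Re_rcis[of "cmod c" "Arg c"] Im_rcis[of "cmod c" "Arg c"]
      by (simp add: clipfree_dilate_cis scaleC_clipfree_def rcis_cmod_Arg scaleR_add_right)
    then have "norm (c *\<^sub>C u) = cmod c * norm (clipfree_dilate (cis (Arg c)) u)" by simp
    also have "\<dots> \<le> cmod c * norm u"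
      using norm_clipfree_dilate[of "cis (Arg c)" u] by (intro mult_left_mono) auto
    finally show ?thesis .
  qed
  show "norm (c *\<^sub>C u) = cmod c * norm u"
  proof (cases "c = 0")
    case True
    then show ?thesis by (simp add: scaleC_clipfree_def)
  next
    case False
    have "inverse c *\<^sub>C (c *\<^sub>C u) = u"
      using False by (simp only: assoc) (simp add: scaleC_clipfree_def)
    then have "norm u \<le> cmod (inverse c) * norm (c *\<^sub>C u)" using le[of "inverse c" "c *\<^sub>C u"] by simp
    then have "cmod c * norm u \<le> norm (c *\<^sub>C u)"
      using False by (simp add: norm_divide field_simps)
    with le[of c u] show ?thesis by simp
  qed
qed

end

lemma scaleC_ii_clipfree_class:
  "\<i> *\<^sub>C clipfree_class (\<delta> x) = clipfree_class (\<delta> (\<i> *\<^sub>C x))"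
  by (simp add: scaleC_clipfree_def clipfree_dilate.abs_eq)

lemma clipfree_lift_norm:
  assumes "norm u < r" shows "\<exists>v. clipfree_class v = u \<and> norm v < r"
proof -
  obtain w where w: "u = clipfree_class w" by (induction u rule: clipfree.abs_induct) blast
  with assms have "0 < r - infdist w Y_T" by (simp add: norm_clipfree.abs_eq)
  from infdist_Y_T_approx[OF this, of w] obtain y where y: "y \<in> Y_T" "norm (w - y) < r" by auto
  then have "clipfree_class (w - y) = u"
    using subspace_neg[OF subspace_Y_T y(1)] by (simp add: w clipfree.abs_eq_iff)
  with y(2) show ?thesis by blast
qed

lemma bounded_linear_clipfree_class: "bounded_linear clipfree_class"
proof (rule bounded_linear_intro)
  fix u v :: "'a lipfree" and r :: real
  show "clipfree_class (u + v) = clipfree_class u + clipfree_class v"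
    by (simp add: plus_clipfree.abs_eq)
  show "clipfree_class (r *\<^sub>R u) = r *\<^sub>R clipfree_class u"
    by (simp add: scaleR_clipfree.abs_eq)
  show "norm (clipfree_class u) \<le> norm u * 1"
    using infdist_Y_T_le[OF subspace_0[OF subspace_Y_T], of u] by (simp add: norm_clipfree.abs_eq)
qed

instance clipfree :: (complex_normed_vector) complex_banach
proof
  fix U :: "nat \<Rightarrow> 'a clipfree"
  assume U: "Cauchy U"
  have "\<forall>n. \<exists>N. \<forall>m\<ge>N. \<forall>k\<ge>N. norm (U m - U k) < (1/2) ^ n"
    using U unfolding Cauchy_iff by simp
  then obtain N where N: "\<And>n m k. m \<ge> N n \<Longrightarrow> k \<ge> N n \<Longrightarrow> norm (U m - U k) < (1/2) ^ n"
    by metis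
  define r where "r n = n + (\<Sum>i\<le>n. N i)" for n
  have r: "strict_mono r" by (rule strict_mono_Suc_iff[THEN iffD2]) (simp add: r_def)
  have "N n \<le> r n" for n unfolding r_def by (cases n) auto
  moreover have "r n \<le> r (Suc n)" for n by (simp add: r_def)
  ultimately have "norm (U (r (Suc n)) - U (r n)) < (1/2) ^ n" for n
    by (meson N order_trans)
  then have "\<forall>n. \<exists>v. clipfree_class v = U (r (Suc n)) - U (r n) \<and> norm v < (1/2) ^ n"
    using clipfree_lift_norm by blast
  then obtain d where d: "\<And>n. clipfree_class (d n) = U (r (Suc n)) - U (r n)"
    "\<And>n. norm (d n) < (1/2) ^ n" by metis
  have "summable (\<lambda>n. (1/2 :: real) ^ n)" by (rule summable_geometric) simp
  then have "summable d"
    by (rule summable_comparison_test'[where N = 0]) (rule less_imp_le[OF d(2)])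
  then have "(\<lambda>n. \<Sum>i<n. d i) \<longlonglongrightarrow> suminf d" by (rule summable_LIMSEQ)
  then have "(\<lambda>n. clipfree_class (\<Sum>i<n. d i)) \<longlonglongrightarrow> clipfree_class (suminf d)"
    by (rule bounded_linear.tendsto[OF bounded_linear_clipfree_class])
  moreover have "clipfree_class (\<Sum>i<n. d i) = U (r n) - U (r 0)" for n
    by (induction n)
      (simp_all add: d(1) linear_0 linear_add bounded_linear.linear[OF bounded_linear_clipfree_class])
  ultimately have "(\<lambda>n. U (r n) - U (r 0)) \<longlonglongrightarrow> clipfree_class (suminf d)" by simp
  then have "(\<lambda>n. U (r n) - U (r 0) + U (r 0)) \<longlonglongrightarrow> clipfree_class (suminf d) + U (r 0)"
    by (intro tendsto_intros)
  then have "(U \<circ> r) \<longlonglongrightarrow> clipfree_class (suminf d) + U (r 0)" by (simp add: o_def)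
  then show "convergent U"
    using Cauchy_converges_subseq U r by (auto simp: convergent_def)
qed

end

theory Submission
  imports Defs
begin

text \<open>
  As in Godefroy and Kalton, separability lets one smooth the Lipschitz right inverse \<open>\<delta>\<close> of the
  barycenter map \<open>\<F>(X) \<rightarrow> X\<close> to a linear one. Averaging \<open>\<delta>\<close> successively over the segments
  \<open>[0, e\<^sub>n]\<close>, where the \<open>e\<^sub>n\<close> point in a dense set of directions and \<open>\<Sum> \<parallel>e\<^sub>n\<parallel> < \<infinity>\<close>,
  gives in the limit a 1-Lipschitz map \<open>\<Phi> : X \<rightarrow> \<F>(X)\<close> which has continuous directional derivatives
  along each \<open>e\<^sub>n\<close> and hence is Gateaux differentiable at \<open>0\<close>. Its derivative \<open>R\<close> is linear, has norm
  at most 1, and is still a right inverse of the barycenter map.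

  The barycenter map factors through \<open>\<F>\<^sub>\<C>(X)\<close>. With \<open>S x\<close> the class of \<open>R x\<close>, the map
  \<open>T x = (S x - \<i> S (\<i> x)) / 2\<close> is complex linear, a contraction by the triangle inequality, and a
  right inverse of the induced complex linear contraction \<open>\<beta> : \<F>\<^sub>\<C>(X) \<rightarrow> X\<close>. Hence \<open>T\<close> is isometric and
  \<open>T \<circ> \<beta>\<close> is the required projection.
\<close>

section \<open>The Hahn--Banach theorem\<close>

definition sublinear :: "('a::real_vector \<Rightarrow> real) \<Rightarrow> bool" where
  "sublinear p \<longleftrightarrow> (\<forall>x y. p (x + y) \<le> p x + p y) \<and> (\<forall>c x. 0 \<le> c \<longrightarrow> p (c *\<^sub>R x) = c * p x)"

lemma sublinearD:
  assumes "sublinear p"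
  shows "p (x + y) \<le> p x + p y" "0 \<le> c \<Longrightarrow> p (c *\<^sub>R x) = c * p x" "p 0 = 0" "- p (- x) \<le> p x"
proof -
  show sub: "p (x + y) \<le> p x + p y" for x y using assms by (simp add: sublinear_def)
  show "0 \<le> c \<Longrightarrow> p (c *\<^sub>R x) = c * p x" for c x using assms by (simp add: sublinear_def)
  from this[of 0 0] show "p 0 = 0" by simp
  with sub[of x "- x"] show "- p (- x) \<le> p x" by simp
qed

text \<open>The reverse inequality for a factor \<open>c\<close> is the assumed one for
  \<open>inverse c\<close>, applied to \<open>c *\<^sub>R x\<close>.\<close>

lemma sublinearI:
  assumes "\<And>x y. p (x + y) \<le> p x + p y" "p 0 = 0" "\<And>c x. 0 < c \<Longrightarrow> p (c *\<^sub>R x) \<le> c * p x"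
  shows "sublinear p"
  unfolding sublinear_def
proof (intro conjI allI impI assms(1))
  fix c :: real and x assume "0 \<le> c"
  show "p (c *\<^sub>R x) = c * p x"
  proof (cases "c = 0")
    case False
    with \<open>0 \<le> c\<close> have c: "0 < c" by simp
    have "p x \<le> inverse c * p (c *\<^sub>R x)" using assms(3)[of "inverse c" "c *\<^sub>R x"] c by simp
    with c have "c * p x \<le> p (c *\<^sub>R x)" by (simp add: field_simps)
    with assms(3)[OF c, of x] show ?thesis by simp
  qed (simp add: assms(2))
qed

text \<open>For sublinear \<open>p\<close> this is the largest sublinear functional below
  \<open>p\<close> whose value at \<open>- y\<close> is at most \<open>- p y\<close>.\<close>

definition sublinear_tilt :: "('a::real_vector \<Rightarrow> real) \<Rightarrow> 'a \<Rightarrow> 'a \<Rightarrow> real" where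
  "sublinear_tilt p y x = (INF t\<in>{0..}. p (x + t *\<^sub>R y) - t * p y)"

lemma sublinear_tilt_le:
  assumes p: "sublinear p" and "0 \<le> t"
  shows "sublinear_tilt p y x \<le> p (x + t *\<^sub>R y) - t * p y"
  unfolding sublinear_tilt_def
proof (rule cINF_lower)
  \<comment> \<open>By subadditivity \<open>- p (- x)\<close> lies below every term, so the infimum
    is a genuine one.\<close>
  show "bdd_below ((\<lambda>t. p (x + t *\<^sub>R y) - t * p y) ` {0..})"
  proof (rule bdd_belowI2)
    fix t :: real assume "t \<in> {0..}"
    then show "- p (- x) \<le> p (x + t *\<^sub>R y) - t * p y"
      using sublinearD(1)[OF p, of "x + t *\<^sub>R y" "- x"] sublinearD(2)[OF p, of t y] by simp
  qed
qed (use assms in simp)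

text \<open>Parameters add: \<open>t\<close> for \<open>x\<close> and \<open>t'\<close> for
  \<open>x'\<close> give the candidate \<open>t + t'\<close> for \<open>x + x'\<close>. Homogeneity
  is the substitution of \<open>c * t\<close> for \<open>t\<close>.\<close>

lemma sublinear_sublinear_tilt:
  assumes p: "sublinear p"
  shows "sublinear (sublinear_tilt p y)"
proof (rule sublinearI)
  let ?q = "sublinear_tilt p y"
  note le = sublinear_tilt_le[OF p, of _ y]
  have greatest: "z \<le> ?q x" if "\<And>t. 0 \<le> t \<Longrightarrow> z \<le> p (x + t *\<^sub>R y) - t * p y" for z x
    unfolding sublinear_tilt_def using that by (intro cINF_greatest) auto
  show "?q (x + x') \<le> ?q x + ?q x'" for x x'
  proof -
    have "?q (x + x') - (p (x + t *\<^sub>R y) - t * p y) \<le> ?q x'" if t: "0 \<le> t" for t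
    proof (rule greatest)
      fix t' :: real assume "0 \<le> t'"
      with t show "?q (x + x') - (p (x + t *\<^sub>R y) - t * p y) \<le> p (x' + t' *\<^sub>R y) - t' * p y"
        using le[of "t + t'" "x + x'"] sublinearD(1)[OF p, of "x + t *\<^sub>R y" "x' + t' *\<^sub>R y"]
        by (simp add: algebra_simps)
    qed
    then have "?q (x + x') - ?q x' \<le> ?q x" by (intro greatest) (simp add: algebra_simps)
    then show ?thesis by simp
  qed
  have "0 \<le> ?q 0" by (rule greatest) (simp add: sublinearD(2)[OF p])
  moreover have "?q 0 \<le> 0" using le[of 0 0] by (simp add: sublinearD(3)[OF p])
  ultimately show "?q 0 = 0" by simp
  fix c :: real and x assume c: "0 < c"
  have "inverse c * ?q (c *\<^sub>R x) \<le> ?q x"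
  proof (rule greatest)
    fix t :: real assume "0 \<le> t"
    with c have "?q (c *\<^sub>R x) \<le> p (c *\<^sub>R (x + t *\<^sub>R y)) - (c * t) * p y"
      using le[of "c * t" "c *\<^sub>R x"] by (simp add: scaleR_add_right)
    also have "\<dots> = c * (p (x + t *\<^sub>R y) - t * p y)"
      using c by (simp only: sublinearD(2)[OF p less_imp_le]) (simp add: algebra_simps)
    finally show "inverse c * ?q (c *\<^sub>R x) \<le> p (x + t *\<^sub>R y) - t * p y"
      using c by (simp add: field_simps)
  qed
  with c show "?q (c *\<^sub>R x) \<le> c * ?q x" by (simp add: field_simps)
qed

text \<open>Of two members of a chain the smaller one can serve for both, which makes the pointwise
  infimum subadditive. The bound \<open>p\<close> provides the common lower bound
  \<open>- p (- x)\<close> at \<open>x\<close>.\<close>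

lemma sublinear_Inf_chain:
  fixes C :: "('a::real_vector \<Rightarrow> real) set"
  assumes "C \<noteq> {}" and sub: "\<And>q. q \<in> C \<Longrightarrow> sublinear q" and bound: "\<And>q x. q \<in> C \<Longrightarrow> q x \<le> p x"
    and chain: "\<And>q r. q \<in> C \<Longrightarrow> r \<in> C \<Longrightarrow> (\<forall>x. q x \<le> r x) \<or> (\<forall>x. r x \<le> q x)"
  shows "sublinear (\<lambda>x. INF q\<in>C. q x)" "q \<in> C \<Longrightarrow> (INF q\<in>C. q x) \<le> q x"
proof -
  let ?i = "\<lambda>x. INF q\<in>C. q x"
  have lower: "?i x \<le> q x" if "q \<in> C" for q x
  proof (rule cINF_lower[OF _ that], rule bdd_belowI2)
    fix r assume r: "r \<in> C"
    show "- p (- x) \<le> r x" using sublinearD(4)[OF sub[OF r], of x] bound[OF r, of "- x"] by simp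
  qed
  then show "q \<in> C \<Longrightarrow> ?i x \<le> q x" .
  show "sublinear ?i"
  proof (rule sublinearI)
    fix x y
    have step: "?i (x + y) \<le> q x + r y" if "q \<in> C" "r \<in> C" for q r
      using chain[OF that]
    proof
      assume "\<forall>x. q x \<le> r x"
      then have "q y \<le> r y" ..
      then show ?thesis
        using lower[OF that(1), of "x + y"] sublinearD(1)[OF sub[OF that(1)], of x y]
        by linarith
    next
      assume "\<forall>x. r x \<le> q x"
      then have "r x \<le> q x" ..
      then show ?thesis
        using lower[OF that(2), of "x + y"] sublinearD(1)[OF sub[OF that(2)], of x y]
        by linarith
    qed
    have "?i (x + y) - q x \<le> ?i y" if "q \<in> C" for q
    proof (rule cINF_greatest[OF \<open>C \<noteq> {}\<close>])
      show "?i (x + y) - q x \<le> r y" if "r \<in> C" for r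
        using step[OF \<open>q \<in> C\<close> that] by simp
    qed
    then have "?i (x + y) - ?i y \<le> ?i x"
      using \<open>C \<noteq> {}\<close> by (intro cINF_greatest) (auto simp: algebra_simps)
    then show "?i (x + y) \<le> ?i x + ?i y" by simp
  next
    have "(\<lambda>q. q 0) ` C = {0}" using \<open>C \<noteq> {}\<close> sublinearD(3)[OF sub] by force
    then show "?i 0 = 0" by simp
  next
    fix c :: real and x assume c: "0 < c"
    have "inverse c * ?i (c *\<^sub>R x) \<le> ?i x"
    proof (rule cINF_greatest[OF \<open>C \<noteq> {}\<close>])
      fix q assume "q \<in> C"
      with c show "inverse c * ?i (c *\<^sub>R x) \<le> q x"
        using lower[of q "c *\<^sub>R x"] sublinearD(2)[OF sub, of q c x] by (simp add: field_simps)
    qed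
    with c show "?i (c *\<^sub>R x) \<le> c * ?i x" by (simp add: field_simps)
  qed
qed

text \<open>A pointwise minimal sublinear functional agrees with all its tilts, and is therefore additive.\<close>

theorem hahn_banach:
  fixes p :: "'a::real_vector \<Rightarrow> real"
  assumes p: "sublinear p"
  shows "\<exists>f. linear f \<and> (\<forall>x. f x \<le> p x)"
proof -
  let ?A = "{q. sublinear q \<and> (\<forall>x. q x \<le> p x)}"
  \<comment> \<open>The order is reversed, so that a maximal element for Zorn's lemma is a pointwise
    minimal sublinear functional.\<close>
  let ?P = "\<lambda>q r :: 'a \<Rightarrow> real. \<forall>x. r x \<le> q x"
  have "\<exists>q\<in>?A. \<forall>r\<in>?A. ?P q r \<longrightarrow> r = q"
  proof (rule predicate_Zorn)
    show "partial_order_on ?A (relation_of ?P ?A)"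
      by (rule partial_order_on_relation_ofI) (auto intro: order_trans intro!: ext antisym)
    fix C assume C: "C \<in> Chains (relation_of ?P ?A)"
    then have CA: "C \<subseteq> ?A" by (auto simp: Chains_def relation_of_def)
    have chain: "?P q r \<or> ?P r q" if "q \<in> C" "r \<in> C" for q r
      using C that by (auto simp: Chains_def relation_of_def)
    show "\<exists>u\<in>?A. \<forall>a\<in>C. ?P a u"
    proof (cases "C = {}")
      case True
      with p show ?thesis by auto
    next
      case False
      note inf = sublinear_Inf_chain[of C p, OF False]
      from False obtain q where "q \<in> C" by blast
      show ?thesis
      proof (intro bexI[of _ "\<lambda>x. INF q\<in>C. q x"] CollectI conjI ballI allI)
        show "sublinear (\<lambda>x. INF q\<in>C. q x)" by (rule inf) (use CA chain in blast)+
        show le: "(INF q\<in>C. q x) \<le> q x" if "q \<in> C" for q x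
          by (rule inf) (use CA chain that in blast)+
        show "(INF q\<in>C. q x) \<le> p x" for x
          using le[OF \<open>q \<in> C\<close>, of x] CA \<open>q \<in> C\<close> by (blast intro: order_trans)
      qed
    qed
  qed
  then obtain q where "q \<in> ?A" and max: "\<forall>r\<in>?A. ?P q r \<longrightarrow> r = q" by blast
  then have q: "sublinear q" "q x \<le> p x" for x by simp_all
  have minimal: "r = q" if r: "sublinear r" "\<And>x. r x \<le> q x" for r
  proof -
    have "r \<in> ?A" using r q(2) by (blast intro: order_trans)
    with max r(2) show ?thesis by blast
  qed
  \<comment> \<open>The parameter \<open>0\<close> puts the tilt below \<open>q\<close>, so
    minimality gives equality; the parameter \<open>1\<close> then yields superadditivity of
    \<open>q\<close>.\<close>
  have tilt: "sublinear_tilt q y = q" for y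
    using sublinear_tilt_le[OF q(1), of 0] by (intro minimal sublinear_sublinear_tilt q) simp
  have add: "q (x + y) = q x + q y" for x y
    using sublinear_tilt_le[OF q(1), of 1 y x] sublinearD(1)[OF q(1), of x y] by (simp add: tilt)
  have neg: "q (- x) = - q x" for x
    using add[of x "- x"] sublinearD(3)[OF q(1)] by simp
  have "q (c *\<^sub>R x) = c * q x" for c x
  proof (cases "0 \<le> c")
    case True
    then show ?thesis by (rule sublinearD(2)[OF q(1)])
  next
    case False
    then show ?thesis using sublinearD(2)[OF q(1), of "- c" x] neg[of "c *\<^sub>R x"] by simp
  qed
  with add have "linear q" by (intro linearI) simp_all
  with q(2) show ?thesis by blast
qed

text \<open>Tilting the norm in the direction \<open>z\<close> before applying
  \<open>hahn_banach\<close> forces \<open>f (- z) \<le> - norm z\<close>, which prescribes the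
  value at \<open>z\<close> without extending from a subspace.\<close>

corollary hahn_banach_norming:
  fixes z :: "'a::real_normed_vector"
  shows "\<exists>f. linear f \<and> (\<forall>x. \<bar>f x\<bar> \<le> norm x) \<and> f z = norm z"
proof -
  have n: "sublinear (norm :: 'a \<Rightarrow> real)" by (rule sublinearI) (simp_all add: norm_triangle_ineq)
  obtain f where f: "linear f" "\<And>x. f x \<le> sublinear_tilt norm z x"
    using hahn_banach[OF sublinear_sublinear_tilt[OF n]] by blast
  have neg: "f (- x) = - f x" for x by (rule linear_neg[OF f(1)])
  have le: "f x \<le> norm x" for x
    using f(2)[of x] sublinear_tilt_le[OF n, of 0 z x] by simp
  have "f (- z) \<le> - norm z"
    using f(2)[of "- z"] sublinear_tilt_le[OF n, of 1 z "- z"] by simp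
  with le[of z] have "f z = norm z" by (simp add: neg)
  moreover have "\<bar>f x\<bar> \<le> norm x" for x using le[of x] le[of "- x"] by (simp add: neg)
  ultimately show ?thesis using f(1) by blast
qed

section \<open>The barycenter map\<close>

lemma lip0_apply_Lip0_linear:
  fixes f :: "'a::real_normed_vector \<Rightarrow> real"
  assumes "bounded_linear f"
  shows "lip0_apply (Lip0 f) = f"
proof (rule Lip0_inverse, rule CollectI, rule conjI)
  interpret bounded_linear f by fact
  obtain K where "0 \<le> K" "\<And>x. norm (f x) \<le> norm x * K" using nonneg_bounded by blast
  then have "K-lipschitz_on UNIV f"
    by (intro lipschitz_onI) (auto simp: dist_norm diff[symmetric] mult.commute)
  then show "\<exists>L. L-lipschitz_on UNIV f" ..
  show "f 0 = 0" by (rule zero)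
qed

text \<open>The barycenter is described weakly, by testing against bounded linear functionals seen
  as Lipschitz functions. It is a relation first, because existence rests on completeness and is
  proved later.\<close>

definition is_barycenter :: "'a::real_normed_vector lipfree \<Rightarrow> 'a \<Rightarrow> bool" where
  "is_barycenter u x \<longleftrightarrow>
    (\<forall>f. bounded_linear f \<longrightarrow> blinfun_apply (lipfree_functional u) (Lip0 f) = f x)"

lemma is_barycenter_delta: "is_barycenter (\<delta> x) x"
  by (simp add: is_barycenter_def \<delta>.rep_eq eval_lip0.rep_eq lip0_apply_Lip0_linear)

lemma is_barycenter_linear:
  "is_barycenter 0 0"
  "is_barycenter u x \<Longrightarrow> is_barycenter v y \<Longrightarrow> is_barycenter (u + v) (x + y)"
  "is_barycenter u x \<Longrightarrow> is_barycenter v y \<Longrightarrow> is_barycenter (u - v) (x - y)"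
  "is_barycenter u x \<Longrightarrow> is_barycenter (r *\<^sub>R u) (r *\<^sub>R x)"
  by (auto simp: is_barycenter_def zero_lipfree.rep_eq plus_lipfree.rep_eq minus_lipfree.rep_eq
      scaleR_lipfree.rep_eq blinfun.bilinear_simps linear_simps linear_0 bounded_linear.linear)

text \<open>A norming functional for \<open>x\<close> is 1-Lipschitz, hence lies in the unit ball of
  the space on which \<open>u\<close> acts. Applied to differences, the bound gives uniqueness and
  controls limits of barycenters.\<close>

lemma norm_is_barycenter_le:
  assumes "is_barycenter u x"
  shows "norm x \<le> norm u"
proof -
  obtain f where f: "linear f" "\<And>y. \<bar>f y\<bar> \<le> norm y" "f x = norm x"
    using hahn_banach_norming by blast
  then have bl: "bounded_linear f"
    by (intro bounded_linear_intro[where K = 1]) (simp_all add: linear_add linear_scale)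
  have "1-lipschitz_on UNIV f"
    using f(2) by (intro lipschitz_onI) (auto simp: dist_norm linear_diff[OF f(1), symmetric])
  then have "norm (Lip0 f) \<le> 1" by (intro norm_lip0_le) (simp add: lip0_apply_Lip0_linear[OF bl])
  have "norm x = blinfun_apply (lipfree_functional u) (Lip0 f)"
    using assms bl f(3) by (simp add: is_barycenter_def)
  also have "\<dots> \<le> norm (lipfree_functional u) * norm (Lip0 f)"
    using norm_blinfun[of "lipfree_functional u" "Lip0 f"] by simp
  also have "\<dots> \<le> norm (lipfree_functional u)"
    using \<open>norm (Lip0 f) \<le> 1\<close> by (simp add: mult_left_le)
  finally show ?thesis by (simp add: norm_lipfree.rep_eq)
qed

lemma is_barycenter_unique: "is_barycenter u x \<Longrightarrow> is_barycenter u y \<Longrightarrow> x = y"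
  using norm_is_barycenter_le[OF is_barycenter_linear(3), of u x u y] by simp

lemma bounded_linear_lipfree_functional: "bounded_linear lipfree_functional"
  by (rule bounded_linear_intro[where K = 1])
    (simp_all add: plus_lipfree.rep_eq scaleR_lipfree.rep_eq norm_lipfree.rep_eq)

text \<open>The elements having a barycenter form a closed subspace containing every
  \<open>\<delta> x\<close>. For closedness, the barycenters along a convergent sequence are Cauchy
  by the norm bound, and their limit passes every linear test.\<close>

lemma is_barycenter_ex:
  fixes u :: "'a::banach lipfree"
  shows "\<exists>x. is_barycenter u x"
proof -
  let ?S = "{u :: 'a lipfree. \<exists>x. is_barycenter u x}"
  have "subspace ?S"
    by (auto simp: subspace_def intro: is_barycenter_linear)
  moreover have "closed ?S"
  proof (rule closed_sequential_limits[THEN iffD2], intro allI impI, elim conjE)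
    fix U :: "nat \<Rightarrow> 'a lipfree" and u
    assume "\<forall>n. U n \<in> ?S" and lim: "U \<longlonglongrightarrow> u"
    then obtain x where x: "\<And>n. is_barycenter (U n) (x n)" by simp metis
    have "Cauchy x"
    proof (rule metric_CauchyI)
      fix e :: real assume "0 < e"
      then obtain N where N: "\<And>m n. m \<ge> N \<Longrightarrow> n \<ge> N \<Longrightarrow> dist (U m) (U n) < e"
        using LIMSEQ_imp_Cauchy[OF lim] unfolding Cauchy_def by metis
      then show "\<exists>N. \<forall>m\<ge>N. \<forall>n\<ge>N. dist (x m) (x n) < e"
        using norm_is_barycenter_le[OF is_barycenter_linear(3)[OF x x]]
        by (metis dist_norm le_less_trans)
    qed
    then obtain y where y: "x \<longlonglongrightarrow> y" using Cauchy_convergent convergent_def by blast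
    have "is_barycenter u y"
      unfolding is_barycenter_def
    proof (intro allI impI)
      fix f :: "'a \<Rightarrow> real" assume f: "bounded_linear f"
      have "(\<lambda>n. blinfun_apply (lipfree_functional (U n)) (Lip0 f))
          \<longlonglongrightarrow> blinfun_apply (lipfree_functional u) (Lip0 f)"
        by (intro tendsto_intros bounded_linear.tendsto[OF bounded_linear_lipfree_functional] lim)
      moreover have "(\<lambda>n. f (x n)) \<longlonglongrightarrow> f y" by (rule bounded_linear.tendsto[OF f y])
      moreover have "blinfun_apply (lipfree_functional (U n)) (Lip0 f) = f (x n)" for n
        using x f by (simp add: is_barycenter_def)
      ultimately show "blinfun_apply (lipfree_functional u) (Lip0 f) = f y"
        using LIMSEQ_unique by simp
    qed
    then show "u \<in> ?S" by blast
  qed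
  ultimately have "u \<in> ?S"
    by (rule lipfree_induct[where T = "\<lambda>u. u", OF bounded_linear_ident])
      (use is_barycenter_delta in blast)
  then show ?thesis by simp
qed

definition barycenter :: "'a::banach lipfree \<Rightarrow> 'a" where
  "barycenter u = (SOME x. is_barycenter u x)"

lemma is_barycenter_barycenter: "is_barycenter u (barycenter u)"
  unfolding barycenter_def by (rule someI_ex[OF is_barycenter_ex])

lemma barycenter_eqI: "is_barycenter u x \<Longrightarrow> barycenter u = x"
  by (rule is_barycenter_unique[OF is_barycenter_barycenter])

lemma barycenter_delta [simp]: "barycenter (\<delta> x) = x"
  by (rule barycenter_eqI[OF is_barycenter_delta])

lemma norm_barycenter_le: "norm (barycenter u) \<le> norm u"
  by (rule norm_is_barycenter_le[OF is_barycenter_barycenter])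

lemma bounded_linear_barycenter: "bounded_linear barycenter"
  by (rule bounded_linear_intro[where K = 1])
    (auto intro!: barycenter_eqI is_barycenter_linear is_barycenter_barycenter simp: norm_barycenter_le)

lemma lipschitz_delta: "1-lipschitz_on UNIV (\<delta> :: 'a::{metric_space, zero} \<Rightarrow> 'a lipfree)"
proof (rule lipschitz_onI)
  fix x y :: 'a
  have "norm (eval_lip0 x - eval_lip0 y) \<le> dist x y"
  proof (rule norm_blinfun_bound)
    show "norm (blinfun_apply (eval_lip0 x - eval_lip0 y) f) \<le> dist x y * norm f" for f
      using lipschitz_onD[OF lip0_lipschitz[of f], of x y]
      by (simp add: blinfun.diff_left eval_lip0.rep_eq dist_norm mult.commute)
  qed simp
  then show "dist (\<delta> x) (\<delta> y) \<le> 1 * dist x y"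
    by (simp add: dist_norm norm_lipfree.rep_eq minus_lipfree.rep_eq \<delta>.rep_eq)
qed simp

section \<open>Lifting Lipschitz right inverses\<close>

definition line_avg :: "'a::real_normed_vector \<Rightarrow> ('a \<Rightarrow> 'b::banach) \<Rightarrow> 'a \<Rightarrow> 'b" where
  "line_avg w \<phi> x = integral {0..1} (\<lambda>t. \<phi> (x + t *\<^sub>R w))"

lemma norm_diff_triangle3: "norm (a - b) \<le> norm (a - c) + norm (c - d) + norm (b - d)"
  for a :: "'a::real_normed_vector"
proof -
  have "a - b = (a - c) + (c - d) - (b - d)" by simp
  then have "norm (a - b) \<le> norm ((a - c) + (c - d)) + norm (b - d)"
    using norm_triangle_ineq4 by metis
  with norm_triangle_ineq[of "a - c" "c - d"] show ?thesis by linarith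
qed

lemma continuous_on_lipschitz_compose:
  assumes "L-lipschitz_on UNIV \<phi>" "continuous_on S g"
  shows "continuous_on S (\<lambda>t. \<phi> (g t))"
  using continuous_on_compose2[OF lipschitz_on_continuous_on[OF assms(1)] assms(2)] by simp

lemma norm_integral_unit_le:
  fixes h :: "real \<Rightarrow> 'b::banach"
  assumes "continuous_on {0..1} h" "\<And>t. t \<in> {0..1} \<Longrightarrow> norm (h t) \<le> B"
  shows "norm (integral {0..1} h) \<le> B"
  using integral_bound[of 0 1 h B] assms by simp

lemma line_avg_diff:
  assumes "1-lipschitz_on UNIV \<phi>"
  shows "line_avg w \<phi> x - line_avg w \<phi> y = integral {0..1} (\<lambda>t. \<phi> (x + t *\<^sub>R w) - \<phi> (y + t *\<^sub>R w))"
  unfolding line_avg_def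
  by (intro Henstock_Kurzweil_Integration.integral_diff[symmetric] integrable_continuous_real
      continuous_on_lipschitz_compose[OF assms] continuous_intros)

lemma lipschitz_line_avg:
  assumes "1-lipschitz_on UNIV \<phi>"
  shows "1-lipschitz_on UNIV (line_avg w \<phi>)"
proof (rule lipschitz_onI)
  fix x y
  have "norm (line_avg w \<phi> x - line_avg w \<phi> y) \<le> dist x y"
    unfolding line_avg_diff[OF assms]
  proof (rule norm_integral_unit_le)
    show "norm (\<phi> (x + t *\<^sub>R w) - \<phi> (y + t *\<^sub>R w)) \<le> dist x y" for t
      using lipschitz_onD[OF assms, of "x + t *\<^sub>R w" "y + t *\<^sub>R w"] by (simp add: dist_norm)
  qed (intro continuous_on_lipschitz_compose[OF assms] continuous_intros)
  then show "dist (line_avg w \<phi> x) (line_avg w \<phi> y) \<le> 1 * dist x y" by (simp add: dist_norm)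
qed simp

text \<open>With directions of summable length this makes successive averages converge
  pointwise.\<close>

lemma norm_line_avg_diff_le:
  assumes "1-lipschitz_on UNIV \<phi>"
  shows "norm (line_avg w \<phi> x - \<phi> x) \<le> norm w"
proof -
  have "line_avg w \<phi> x - \<phi> x = integral {0..1} (\<lambda>t. \<phi> (x + t *\<^sub>R w) - \<phi> x)"
    unfolding line_avg_def
    by (subst Henstock_Kurzweil_Integration.integral_diff)
      (auto intro!: integrable_continuous_real continuous_on_lipschitz_compose[OF assms] continuous_intros)
  also have "norm \<dots> \<le> norm w"
  proof (rule norm_integral_unit_le)
    fix t :: real assume "t \<in> {0..1}"
    then show "norm (\<phi> (x + t *\<^sub>R w) - \<phi> x) \<le> norm w"
      using lipschitz_onD[OF assms, of "x + t *\<^sub>R w" x] mult_right_mono[of t 1 "norm w"]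
      by (simp add: dist_norm)
  qed (intro continuous_on_lipschitz_compose[OF assms] continuous_intros)
  finally show ?thesis .
qed

text \<open>The property is carried on differences because averaging shifts values: from
  \<open>B (\<phi> x) = x\<close> for all \<open>x\<close>, the average at \<open>x\<close> is sent
  to \<open>x + w /\<^sub>R 2\<close>.\<close>

lemma right_inverse_line_avg:
  assumes B: "bounded_linear B" and \<phi>: "1-lipschitz_on UNIV \<phi>"
    and inv: "\<And>x y. B (\<phi> x - \<phi> y) = x - y"
  shows "B (line_avg w \<phi> x - line_avg w \<phi> y) = x - y"
proof -
  have "(\<lambda>t. \<phi> (x + t *\<^sub>R w) - \<phi> (y + t *\<^sub>R w)) integrable_on {0..1}"
    by (intro integrable_continuous_real continuous_on_lipschitz_compose[OF \<phi>] continuous_intros)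
  from integral_linear[OF this B]
  show ?thesis unfolding line_avg_diff[OF \<phi>] by (simp add: o_def inv)
qed

section \<open>Uniform smoothness along a direction\<close>

definition diff_quot :: "('a::real_normed_vector \<Rightarrow> 'b::real_normed_vector) \<Rightarrow> 'a \<Rightarrow> real \<Rightarrow> 'a \<Rightarrow> 'b" where
  "diff_quot \<phi> v s x = (\<phi> (x + s *\<^sub>R v) - \<phi> x) /\<^sub>R s"

text \<open>A derivative-free way of saying that the directional derivative along \<open>v\<close> exists, is Lipschitz,
  and is approximated by difference quotients at a uniform linear rate. In this form the condition
  visibly survives averaging and pointwise limits.\<close>

definition smooth_along :: "real \<Rightarrow> 'a::real_normed_vector \<Rightarrow> ('a \<Rightarrow> 'b::real_normed_vector) \<Rightarrow> bool" where
  "smooth_along C v \<phi> \<longleftrightarrow> (\<forall>s>0. \<forall>t>0. \<forall>x y.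
    norm (diff_quot \<phi> v s x - diff_quot \<phi> v t y) \<le> C * (s + t + norm (x - y)))"

lemma smooth_alongD:
  "smooth_along C v \<phi> \<Longrightarrow> 0 < s \<Longrightarrow> 0 < t \<Longrightarrow>
    norm (diff_quot \<phi> v s x - diff_quot \<phi> v t y) \<le> C * (s + t + norm (x - y))"
  by (simp add: smooth_along_def)

text \<open>Difference quotients commute with averaging, and shifting both base points by
  \<open>r *\<^sub>R w\<close> preserves \<open>norm (x - y)\<close>, so the bound holds under the
  integral with the same \<open>C\<close>.\<close>

lemma smooth_along_line_avg:
  assumes \<phi>: "1-lipschitz_on UNIV \<phi>" and C: "smooth_along C v \<phi>"
  shows "smooth_along C v (line_avg w \<phi>)"
  unfolding smooth_along_def
proof (intro allI impI)
  fix s t :: real and x y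
  assume st: "0 < s" "0 < t"
  have cont: "continuous_on {0..1} (\<lambda>r. diff_quot \<phi> v s (x + r *\<^sub>R w))" for s x
    unfolding diff_quot_def by (intro continuous_on_lipschitz_compose[OF \<phi>] continuous_intros)
  have "diff_quot (line_avg w \<phi>) v s x = integral {0..1} (\<lambda>r. diff_quot \<phi> v s (x + r *\<^sub>R w))" for s x
    unfolding diff_quot_def line_avg_diff[OF \<phi>] integral_cmul[symmetric] by (simp add: add_ac)
  then have "diff_quot (line_avg w \<phi>) v s x - diff_quot (line_avg w \<phi>) v t y
      = integral {0..1} (\<lambda>r. diff_quot \<phi> v s (x + r *\<^sub>R w) - diff_quot \<phi> v t (y + r *\<^sub>R w))"
    by (simp add: Henstock_Kurzweil_Integration.integral_diff integrable_continuous_real cont)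
  also have "norm \<dots> \<le> C * (s + t + norm (x - y))"
  proof (rule norm_integral_unit_le)
    show "norm (diff_quot \<phi> v s (x + r *\<^sub>R w) - diff_quot \<phi> v t (y + r *\<^sub>R w))
        \<le> C * (s + t + norm (x - y))" for r
      using smooth_alongD[OF C st, of "x + r *\<^sub>R w" "y + r *\<^sub>R w"] by simp
  qed (intro continuous_intros cont)
  finally show "norm (diff_quot (line_avg w \<phi>) v s x - diff_quot (line_avg w \<phi>) v t y)
      \<le> C * (s + t + norm (x - y))" .
qed

text \<open>For fixed \<open>s\<close>, \<open>t\<close>, \<open>x\<close>, \<open>y\<close> the
  estimate involves four values of the function, so it passes to pointwise limits. Smoothness is
  asked for eventually because in an iteration each direction enters only from some step on.\<close>

lemma smooth_along_limit:
  assumes C: "eventually (\<lambda>n. smooth_along C v (\<phi> n)) sequentially"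
    and lim: "\<And>x. (\<lambda>n. \<phi> n x) \<longlonglongrightarrow> \<Phi> x"
  shows "smooth_along C v \<Phi>"
  unfolding smooth_along_def
proof (intro allI impI)
  fix s t :: real and x y
  assume st: "0 < s" "0 < t"
  show "norm (diff_quot \<Phi> v s x - diff_quot \<Phi> v t y) \<le> C * (s + t + norm (x - y))"
  proof (rule tendsto_upperbound)
    show "(\<lambda>n. norm (diff_quot (\<phi> n) v s x - diff_quot (\<phi> n) v t y))
        \<longlonglongrightarrow> norm (diff_quot \<Phi> v s x - diff_quot \<Phi> v t y)"
      unfolding diff_quot_def by (intro tendsto_intros lim)
    show "\<forall>\<^sub>F n in sequentially. norm (diff_quot (\<phi> n) v s x - diff_quot (\<phi> n) v t y)
        \<le> C * (s + t + norm (x - y))"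
      using C by eventually_elim (rule smooth_alongD[OF _ st])
  qed simp
qed

lemma smooth_along_nonneg:
  assumes "smooth_along C v \<phi>" shows "0 \<le> C"
  using order_trans[OF norm_ge_zero smooth_alongD[OF assms, of 1 1 0 0]] by simp

text \<open>A step \<open>s\<close> along \<open>v\<close> is a step \<open>s / c\<close> along
  \<open>c *\<^sub>R v\<close>, and the quotient changes by the factor \<open>1 / c\<close>. This
  carries smoothness from shortened directions back to the original dense ones.\<close>

lemma smooth_along_scale:
  assumes C: "smooth_along C (c *\<^sub>R v) \<phi>" and c: "0 < c"
  shows "smooth_along (C / c * (1 + 1 / c)) v \<phi>"
  unfolding smooth_along_def
proof (intro allI impI)
  fix s t :: real and x y
  assume st: "0 < s" "0 < t"
  have "diff_quot \<phi> v s x = diff_quot \<phi> (c *\<^sub>R v) (s / c) x /\<^sub>R c" for s x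
    using c by (simp add: diff_quot_def inverse_eq_divide)
  then have "norm (diff_quot \<phi> v s x - diff_quot \<phi> v t y)
      = norm (diff_quot \<phi> (c *\<^sub>R v) (s / c) x - diff_quot \<phi> (c *\<^sub>R v) (t / c) y) / c"
    using c by (simp add: scaleR_diff_right[symmetric] divide_inverse_commute)
  also have "\<dots> \<le> C * (s / c + t / c + norm (x - y)) / c"
    using c st by (intro divide_right_mono smooth_alongD[OF C]) auto
  also have "\<dots> = C / c * (s / c + t / c + norm (x - y))" by simp
  also have "s / c + t / c + norm (x - y) \<le> (1 + 1 / c) * (s + t + norm (x - y))"
    using c st by (simp add: field_simps)
  then have "C / c * (s / c + t / c + norm (x - y)) \<le> C / c * ((1 + 1 / c) * (s + t + norm (x - y)))"
    using c smooth_along_nonneg[OF C] by (intro mult_left_mono) auto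
  finally show "norm (diff_quot \<phi> v s x - diff_quot \<phi> v t y)
      \<le> C / c * (1 + 1 / c) * (s + t + norm (x - y))" by (simp add: mult.assoc)
qed

text \<open>By the fundamental theorem of calculus the derivative of \<open>line_avg v \<phi>\<close> along \<open>v\<close>
  is \<open>x \<mapsto> \<phi> (x + v) - \<phi> x\<close>.\<close>

lemma line_avg_increment:
  assumes \<phi>: "1-lipschitz_on UNIV \<phi>" and s: "0 < s"
  shows "line_avg v \<phi> (x + s *\<^sub>R v) - line_avg v \<phi> x
    = integral {0..s} (\<lambda>r. \<phi> (x + v + r *\<^sub>R v) - \<phi> (x + r *\<^sub>R v))"
proof -
  let ?g = "\<lambda>r. \<phi> (x + r *\<^sub>R v)"
  have int: "?g integrable_on {a..b}" for a b
    by (intro integrable_continuous_real continuous_on_lipschitz_compose[OF \<phi>] continuous_intros)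
  have shift: "integral {a..b} (?g \<circ> (+) c) = integral {a + c..b + c} ?g" for a b c
    by (rule integral_shift_Icc_real)
  \<comment> \<open>Splitting \<open>{0..1 + s}\<close> both at \<open>1\<close> and at
    \<open>s\<close> avoids distinguishing whether \<open>s\<close> exceeds
    \<open>1\<close>.\<close>
  have comb: "integral {0..1} ?g + integral {1..1 + s} ?g = integral {0..s} ?g + integral {s..1 + s} ?g"
    using s int by (simp add: Henstock_Kurzweil_Integration.integral_combine)
  have rearrange: "d - a = b - c" if "a + b = c + d" for a b c d :: 'b
    using that by (simp add: algebra_simps)
  have "line_avg v \<phi> (x + s *\<^sub>R v) - line_avg v \<phi> x = integral {s..1 + s} ?g - integral {0..1} ?g"
    using shift[of 0 1 s] by (simp add: line_avg_def o_def algebra_simps)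
  also have "\<dots> = integral {1..1 + s} ?g - integral {0..s} ?g" by (rule rearrange[OF comb])
  also have "integral {1..1 + s} ?g = integral {0..s} (\<lambda>r. \<phi> (x + v + r *\<^sub>R v))"
    using shift[of 0 s 1] by (simp add: o_def algebra_simps)
  also have "\<dots> - integral {0..s} ?g = integral {0..s} (\<lambda>r. \<phi> (x + v + r *\<^sub>R v) - ?g r)"
    by (intro Henstock_Kurzweil_Integration.integral_diff[symmetric] int integrable_continuous_real
        continuous_on_lipschitz_compose[OF \<phi>] continuous_intros)
  finally show ?thesis .
qed

text \<open>Each quotient is compared with the exact derivative
  \<open>\<phi> (x + v) - \<phi> x\<close>, a 2-Lipschitz function of \<open>x\<close>; within a
  step \<open>s\<close> along \<open>v\<close> it varies by at most
  \<open>2 * s * norm v\<close>.\<close>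

lemma smooth_along_line_avg_self:
  assumes \<phi>: "1-lipschitz_on UNIV \<phi>"
  shows "smooth_along (2 * (1 + norm v)) v (line_avg v \<phi>)"
  unfolding smooth_along_def
proof (intro allI impI)
  fix s t :: real and x y
  assume st: "0 < s" "0 < t"
  let ?D = "\<lambda>x. \<phi> (x + v) - \<phi> x"
  have lip: "norm (\<phi> a - \<phi> b) \<le> norm (a - b)" for a b
    using lipschitz_onD[OF \<phi>, of a b] by (simp add: dist_norm)
  have D: "norm (?D x - ?D y) \<le> 2 * norm (x - y)" for x y
    using norm_triangle_ineq4[of "\<phi> (x + v) - \<phi> (y + v)" "\<phi> x - \<phi> y"] lip[of "x + v" "y + v"] lip[of x y]
    by (simp add: algebra_simps)
  have q: "norm (diff_quot (line_avg v \<phi>) v s x - ?D x) \<le> 2 * s * norm v" if s: "0 < s" for s x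
  proof -
    have cont: "continuous_on {0..s} (\<lambda>r. \<phi> (x + v + r *\<^sub>R v) - \<phi> (x + r *\<^sub>R v))"
      by (intro continuous_on_lipschitz_compose[OF \<phi>] continuous_intros)
    have "s *\<^sub>R (diff_quot (line_avg v \<phi>) v s x - ?D x)
        = integral {0..s} (\<lambda>r. \<phi> (x + v + r *\<^sub>R v) - \<phi> (x + r *\<^sub>R v)) - s *\<^sub>R ?D x"
      using s by (simp add: diff_quot_def line_avg_increment[OF \<phi>] scaleR_diff_right)
    also have "\<dots> = integral {0..s} (\<lambda>r. ?D (x + r *\<^sub>R v) - ?D x)"
      using s cont by (subst Henstock_Kurzweil_Integration.integral_diff)
        (auto intro: integrable_continuous_real simp: algebra_simps)
    also have "norm \<dots> \<le> 2 * (s * norm v) * (s - 0)"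
    proof (rule integral_bound)
      show "continuous_on {0..s} (\<lambda>r. ?D (x + r *\<^sub>R v) - ?D x)"
        by (intro continuous_on_lipschitz_compose[OF \<phi>] continuous_intros)
      fix r assume "r \<in> {0..s}"
      then have "r * norm v \<le> s * norm v" by (intro mult_right_mono) auto
      with \<open>r \<in> {0..s}\<close> show "norm (?D (x + r *\<^sub>R v) - ?D x) \<le> 2 * (s * norm v)"
        using D[of "x + r *\<^sub>R v" x] by simp
    qed (use s in simp)
    finally show ?thesis using s by (simp add: mult_ac)
  qed
  have "norm (diff_quot (line_avg v \<phi>) v s x - diff_quot (line_avg v \<phi>) v t y)
      \<le> norm (diff_quot (line_avg v \<phi>) v s x - ?D x) + norm (?D x - ?D y)
        + norm (diff_quot (line_avg v \<phi>) v t y - ?D y)"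
    by (rule norm_diff_triangle3)
  also have "\<dots> \<le> 2 * s * norm v + 2 * norm (x - y) + 2 * t * norm v"
    by (intro add_mono q st D)
  also have "\<dots> \<le> 2 * (1 + norm v) * (s + t + norm (x - y))"
    using st by (simp add: algebra_simps)
  finally show "norm (diff_quot (line_avg v \<phi>) v s x - diff_quot (line_avg v \<phi>) v t y)
      \<le> 2 * (1 + norm v) * (s + t + norm (x - y))" .
qed

section \<open>Iterated averages\<close>

primrec iterated_avg :: "(nat \<Rightarrow> 'a::real_normed_vector) \<Rightarrow> ('a \<Rightarrow> 'b::banach) \<Rightarrow> nat \<Rightarrow> 'a \<Rightarrow> 'b" where
  "iterated_avg e \<phi> 0 = \<phi>"
| "iterated_avg e \<phi> (Suc n) = line_avg (e n) (iterated_avg e \<phi> n)"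

lemma lipschitz_iterated_avg:
  "1-lipschitz_on UNIV \<phi> \<Longrightarrow> 1-lipschitz_on UNIV (iterated_avg e \<phi> n)"
  by (induction n) (simp_all add: lipschitz_line_avg)

text \<open>Smoothness along \<open>e k\<close> is created by averaging along \<open>e k\<close> and
  preserved by all later averages. The constant does not depend on \<open>n\<close>, so it survives
  the limit.\<close>

lemma smooth_along_iterated_avg:
  assumes \<phi>: "1-lipschitz_on UNIV \<phi>" and "k < n"
  shows "smooth_along (2 * (1 + norm (e k))) (e k) (iterated_avg e \<phi> n)"
  using \<open>k < n\<close>
proof (induction n)
  case (Suc n)
  note lip = lipschitz_iterated_avg[OF \<phi>, of e n]
  show ?case
  proof (cases "k = n")
    case True
    then show ?thesis using smooth_along_line_avg_self[OF lip] by simp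
  next
    case False
    with Suc show ?thesis using smooth_along_line_avg[OF lip] by simp
  qed
qed simp

lemma right_inverse_iterated_avg:
  assumes "bounded_linear B" "1-lipschitz_on UNIV \<phi>" "\<And>x y. B (\<phi> x - \<phi> y) = x - y"
  shows "B (iterated_avg e \<phi> n x - iterated_avg e \<phi> n y) = x - y"
  using assms
  by (induction n arbitrary: x y) (simp_all add: right_inverse_line_avg lipschitz_iterated_avg)

text \<open>The increments are dominated by \<open>norm (e n)\<close>, so their telescoping series
  converges.\<close>

lemma convergent_iterated_avg:
  assumes \<phi>: "1-lipschitz_on UNIV \<phi>" and e: "summable (\<lambda>n. norm (e n))"
  shows "convergent (\<lambda>n. iterated_avg e \<phi> n x)"
proof -
  let ?d = "\<lambda>n. iterated_avg e \<phi> (Suc n) x - iterated_avg e \<phi> n x"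
  have "summable ?d"
    by (rule summable_comparison_test'[OF e, where N = 0])
      (simp add: norm_line_avg_diff_le lipschitz_iterated_avg \<phi>)
  then have "(\<lambda>n. \<phi> x + sum ?d {..<n}) \<longlonglongrightarrow> \<phi> x + suminf ?d"
    by (intro tendsto_intros summable_LIMSEQ)
  moreover have "\<phi> x + sum ?d {..<n} = iterated_avg e \<phi> n x" for n
    by (subst sum_lessThan_telescope) simp
  ultimately show ?thesis by (auto simp: convergent_def)
qed

section \<open>The Gateaux derivative at the origin\<close>

lemma additive_lipschitz_imp_linear:
  fixes R :: "'a::real_normed_vector \<Rightarrow> 'b::real_normed_vector"
  assumes add: "\<And>x y. R (x + y) = R x + R y" and norm: "\<And>x. norm (R x) \<le> norm x"
  shows "linear R"
proof (rule linearI[OF add])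
  have R0: "R 0 = 0" using norm[of 0] by simp
  have nat: "R (of_nat n *\<^sub>R x) = of_nat n *\<^sub>R R x" for n x
    by (induction n) (simp_all add: R0 add scaleR_add_left)
  have neg: "R (- x) = - R x" for x
    using add[of x "- x"] R0 by (simp add: eq_neg_iff_add_eq_0 add.commute)
  have int: "R (of_int k *\<^sub>R x) = of_int k *\<^sub>R R x" for k x
    by (cases k rule: int_cases2) (simp_all add: nat neg)
  fix c :: real and x
  \<comment> \<open>Replacing \<open>of_nat n * c\<close> by its floor leaves a remainder of modulus
    at most \<open>1\<close>, where the norm bound applies. Since \<open>n\<close> is arbitrary, the
    Archimedean property makes the defect vanish.\<close>
  have "of_nat n * norm (R (c *\<^sub>R x) - c *\<^sub>R R x) \<le> 2 * norm x" for n
  proof -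
    define k where "k = \<lfloor>of_nat n * c\<rfloor>"
    define f where "f = of_nat n * c - of_int k"
    have f: "\<bar>f\<bar> \<le> 1" unfolding f_def k_def by linarith
    have "of_nat n *\<^sub>R R (c *\<^sub>R x) = R (of_int k *\<^sub>R x + f *\<^sub>R x)"
      by (simp add: nat[symmetric] f_def scaleR_add_left[symmetric])
    also have "\<dots> = of_int k *\<^sub>R R x + R (f *\<^sub>R x)" by (simp add: add int)
    finally have "of_nat n *\<^sub>R (R (c *\<^sub>R x) - c *\<^sub>R R x) = R (f *\<^sub>R x) - f *\<^sub>R R x"
      by (simp add: f_def algebra_simps)
    then have "of_nat n * norm (R (c *\<^sub>R x) - c *\<^sub>R R x) = norm (R (f *\<^sub>R x) - f *\<^sub>R R x)"
      by (metis abs_of_nat norm_scaleR)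
    also have "\<dots> \<le> norm (f *\<^sub>R x) + norm (f *\<^sub>R R x)"
      using norm_triangle_ineq4[of "R (f *\<^sub>R x)" "f *\<^sub>R R x"] norm[of "f *\<^sub>R x"] by linarith
    also have "\<dots> \<le> norm x + norm x"
      using f norm[of x] mult_mono[OF f norm[of x]] mult_right_mono[OF f, of "norm x"]
      by (intro add_mono) simp_all
    finally show ?thesis by simp
  qed
  then have "norm (R (c *\<^sub>R x) - c *\<^sub>R R x) \<le> 0"
    by (metis mult.commute not_less reals_Archimedean3)
  then show "R (c *\<^sub>R x) = c *\<^sub>R R x" by simp
qed

text \<open>Difference quotients at \<open>0\<close> are 1-Lipschitz in the direction, uniformly in
  the step. Hence convergence and additivity extend from the dense set of smooth directions to all
  directions.\<close>

theorem gateaux_derivative: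
  fixes \<Phi> :: "'a::real_normed_vector \<Rightarrow> 'b::banach"
  assumes \<Phi>: "1-lipschitz_on UNIV \<Phi>" and dense: "closure {v. \<exists>C. smooth_along C v \<Phi>} = UNIV"
  shows "\<exists>R. linear R \<and> (\<forall>x. norm (R x) \<le> norm x) \<and>
    (\<forall>x. (\<lambda>n. diff_quot \<Phi> x (1 / Suc n) 0) \<longlonglongrightarrow> R x)"
proof -
  define s where "s n = 1 / real (Suc n)" for n
  have s: "0 < s n" "s \<longlonglongrightarrow> 0" for n
    unfolding s_def by (simp, rule LIMSEQ_Suc[OF lim_1_over_n])
  let ?q = "\<lambda>n x. diff_quot \<Phi> x (s n) 0"
  have q: "norm (diff_quot \<Phi> x (s n) z - diff_quot \<Phi> y (s n) z) \<le> norm (x - y)" for n x y z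
  proof -
    have "diff_quot \<Phi> x (s n) z - diff_quot \<Phi> y (s n) z
        = (\<Phi> (z + s n *\<^sub>R x) - \<Phi> (z + s n *\<^sub>R y)) /\<^sub>R s n"
      by (simp add: diff_quot_def algebra_simps)
    moreover have "norm (\<Phi> (z + s n *\<^sub>R x) - \<Phi> (z + s n *\<^sub>R y)) \<le> s n * norm (x - y)"
      using lipschitz_onD[OF \<Phi>, of "z + s n *\<^sub>R x" "z + s n *\<^sub>R y"] s(1)[of n]
      by (simp add: dist_norm scaleR_diff_right[symmetric])
    ultimately show ?thesis using s(1)[of n]
      by (simp add: divide_inverse_commute[symmetric] divide_le_eq mult.commute)
  qed
  have approx: "\<exists>v C. smooth_along C v \<Phi> \<and> norm (x - v) < e" if "0 < e" for x e
  proof -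
    have "x \<in> closure {v. \<exists>C. smooth_along C v \<Phi>}" by (simp add: dense)
    with that show ?thesis unfolding closure_approachable by (auto simp: dist_norm norm_minus_commute)
  qed
  have "Cauchy (\<lambda>n. ?q n x)" for x
  proof (rule CauchyI)
    fix e :: real assume e: "0 < e"
    \<comment> \<open>Four errors add up to \<open>e\<close>: two from replacing \<open>x\<close> by
      \<open>v\<close>, and two from \<open>C * s m\<close> and \<open>C * s n\<close>.\<close>
    then obtain v C where v: "smooth_along C v \<Phi>" "norm (x - v) < e / 4"
      using approx[of "e / 4" x] zero_less_divide_iff[of e 4] by (metis zero_less_numeral)
    have "(\<lambda>n. C * s n) \<longlonglongrightarrow> C * 0" by (intro tendsto_intros s)
    then have "\<forall>\<^sub>F n in sequentially. C * s n < e / 4"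
      using e by (intro order_tendstoD) auto
    then obtain N where N: "\<And>n. n \<ge> N \<Longrightarrow> C * s n < e / 4" by (auto simp: eventually_sequentially)
    show "\<exists>N. \<forall>m\<ge>N. \<forall>n\<ge>N. norm (?q m x - ?q n x) < e"
    proof (intro exI allI impI)
      fix m n assume mn: "m \<ge> N" "n \<ge> N"
      have "norm (?q m x - ?q n x) \<le> norm (?q m x - ?q m v) + norm (?q m v - ?q n v) + norm (?q n x - ?q n v)"
        by (rule norm_diff_triangle3)
      also have "norm (?q m v - ?q n v) \<le> C * s m + C * s n"
        using smooth_alongD[OF v(1) s(1)[of m] s(1)[of n], of 0 0] by (simp add: algebra_simps)
      finally show "norm (?q m x - ?q n x) < e"
        using q[of x m 0 v] q[of x n 0 v] v(2) N[OF mn(1)] N[OF mn(2)] by linarith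
    qed
  qed
  then have "\<forall>x. \<exists>l. (\<lambda>n. ?q n x) \<longlonglongrightarrow> l" by (simp add: Cauchy_convergent_iff convergent_def)
  then obtain R where R: "\<And>x. (\<lambda>n. ?q n x) \<longlonglongrightarrow> R x" by metis
  have Rdiff: "norm (R x - R y) \<le> norm (x - y)" for x y
    by (rule tendsto_upperbound[OF tendsto_norm[OF tendsto_diff[OF R R]]])
      (simp_all add: q always_eventually)
  have "R 0 = 0" using R[of 0] by (simp add: diff_quot_def LIMSEQ_const_iff)
  with Rdiff[of _ 0] have norm: "norm (R x) \<le> norm x" for x by simp
  have add: "R (w + v) = R w + R v" if v: "smooth_along C v \<Phi>" for C v w
  proof -
    have "(\<lambda>n. norm (?q n (w + v) - ?q n w - ?q n v)) \<longlonglongrightarrow> 0"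
    proof (rule tendsto_sandwich[OF _ _ tendsto_const])
      show "\<forall>\<^sub>F n in sequentially. norm (?q n (w + v) - ?q n w - ?q n v) \<le> C * (s n + s n + s n * norm w)"
      proof (intro always_eventually allI)
        fix n
        \<comment> \<open>The increment is a quotient along \<open>v\<close> based at
          \<open>s n *\<^sub>R w\<close>, a point tending to \<open>0\<close>; smoothness along
          \<open>v\<close> compares it with the quotient based at \<open>0\<close>.\<close>
        have "?q n (w + v) - ?q n w = diff_quot \<Phi> v (s n) (s n *\<^sub>R w)"
          by (simp add: diff_quot_def algebra_simps)
        then show "norm (?q n (w + v) - ?q n w - ?q n v) \<le> C * (s n + s n + s n * norm w)"
          using smooth_alongD[OF v s(1)[of n] s(1)[of n], of "s n *\<^sub>R w" 0] s(1)[of n] by simp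
      qed
      have "(\<lambda>n. C * (s n + s n + s n * norm w)) \<longlonglongrightarrow> C * (0 + 0 + 0 * norm w)"
        by (intro tendsto_intros s)
      then show "(\<lambda>n. C * (s n + s n + s n * norm w)) \<longlonglongrightarrow> 0" by simp
    qed simp
    moreover have "(\<lambda>n. norm (?q n (w + v) - ?q n w - ?q n v)) \<longlonglongrightarrow> norm (R (w + v) - R w - R v)"
      by (intro tendsto_intros R)
    ultimately have "norm (R (w + v) - R w - R v) = 0" by (rule LIMSEQ_unique[symmetric])
    then show ?thesis by (simp add: algebra_simps)
  qed
  have "R (w + x) = R w + R x" for w x
  proof -
    have "norm (R (w + x) - R w - R x) \<le> 0"
    proof (rule field_le_epsilon)
      fix e :: real assume "0 < e"
      then obtain v C where v: "smooth_along C v \<Phi>" "norm (x - v) < e / 2"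
        using approx[of "e / 2" x] by (metis half_gt_zero)
      have "R (w + x) - R w - R x = (R (w + x) - R (w + v)) - (R x - R v)"
        by (simp add: add[OF v(1)])
      then have "norm (R (w + x) - R w - R x) \<le> norm (R (w + x) - R (w + v)) + norm (R x - R v)"
        by (simp only: norm_triangle_ineq4)
      then show "norm (R (w + x) - R w - R x) \<le> 0 + e"
        using Rdiff[of "w + x" "w + v"] Rdiff[of x v] v(2) by simp
    qed
    then show ?thesis by (simp add: algebra_simps)
  qed
  then have "linear R" using norm by (rule additive_lipschitz_imp_linear)
  with norm R show ?thesis unfolding s_def by blast
qed

section \<open>Passage to a linear right inverse\<close>

theorem lipschitz_lifting:
  fixes B :: "'b::banach \<Rightarrow> 'a::real_normed_vector"
  assumes sep: "separable_space (euclidean :: 'a topology)"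
    and B: "bounded_linear B" and \<phi>: "1-lipschitz_on UNIV \<phi>" and inv: "\<And>x. B (\<phi> x) = x"
  shows "\<exists>R. linear R \<and> (\<forall>x. norm (R x) \<le> norm x) \<and> (\<forall>x. B (R x) = x)"
proof -
  obtain D :: "'a set" where D: "countable D" "closure D = UNIV"
    using sep by (auto simp: separable_space_def)
  then have "D \<noteq> {}" by auto
  define d where "d = from_nat_into D"
  have d: "range d = D" unfolding d_def by (rule range_from_nat_into[OF \<open>D \<noteq> {}\<close> D(1)])
  \<comment> \<open>The factor \<open>(1/2) ^ n\<close> makes the lengths summable; the added
    \<open>1\<close> keeps the weight positive even when \<open>d n = 0\<close>.\<close>
  define c where "c n = (1/2) ^ n / (1 + norm (d n))" for n
  have c: "0 < c n" for n by (simp add: c_def add_pos_nonneg)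
  define e where "e n = c n *\<^sub>R d n" for n
  have "norm (e n) \<le> (1/2) ^ n" for n
    using c[of n] by (simp add: e_def c_def field_simps add_pos_nonneg)
  then have e: "summable (\<lambda>n. norm (e n))"
    by (intro summable_comparison_test'[OF summable_geometric[of "1/2"], where N = 0]) simp_all
  let ?I = "iterated_avg e \<phi>"
  obtain \<Phi> where lim: "\<And>x. (\<lambda>n. ?I n x) \<longlonglongrightarrow> \<Phi> x"
    using convergent_iterated_avg[OF \<phi> e] unfolding convergent_def by metis
  have lip: "1-lipschitz_on UNIV \<Phi>"
  proof (rule lipschitz_onI)
    show "dist (\<Phi> x) (\<Phi> y) \<le> 1 * dist x y" for x y
      using lipschitz_onD[OF lipschitz_iterated_avg[OF \<phi>]]
      by (intro tendsto_upperbound[OF tendsto_dist[OF lim lim]]) auto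
  qed simp
  \<comment> \<open>\<open>B (\<Phi> x)\<close> equals \<open>x\<close> up to a constant vector,
    which cancels in difference quotients.\<close>
  have Binv: "B (\<Phi> x - \<Phi> y) = x - y" for x y
  proof (rule LIMSEQ_unique)
    show "(\<lambda>n. B (?I n x - ?I n y)) \<longlonglongrightarrow> B (\<Phi> x - \<Phi> y)"
      by (intro bounded_linear.tendsto[OF B] tendsto_intros lim)
    have "B (\<phi> x - \<phi> y) = x - y" for x y
      by (simp add: inv linear_diff bounded_linear.linear[OF B])
    then show "(\<lambda>n. B (?I n x - ?I n y)) \<longlonglongrightarrow> x - y"
      by (simp add: right_inverse_iterated_avg[OF B \<phi>])
  qed
  have "\<exists>C. smooth_along C (d k) \<Phi>" for k
  proof -
    have "smooth_along (2 * (1 + norm (e k))) (e k) \<Phi>"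
      by (rule smooth_along_limit[OF eventually_mono[OF eventually_gt_at_top[of k]] lim])
        (rule smooth_along_iterated_avg[OF \<phi>])
    then show ?thesis using smooth_along_scale[OF _ c] unfolding e_def by blast
  qed
  then have "D \<subseteq> {v. \<exists>C. smooth_along C v \<Phi>}" using d by auto
  then have "closure {v. \<exists>C. smooth_along C v \<Phi>} = UNIV" using closure_mono D(2) by blast
  from gateaux_derivative[OF lip this] obtain R where R: "linear R" "\<And>x. norm (R x) \<le> norm x"
    "\<And>x. (\<lambda>n. diff_quot \<Phi> x (1 / Suc n) 0) \<longlonglongrightarrow> R x" by blast
  have "B (R x) = x" for x
  proof (rule LIMSEQ_unique)
    show "(\<lambda>n. B (diff_quot \<Phi> x (1 / Suc n) 0)) \<longlonglongrightarrow> B (R x)"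
      by (rule bounded_linear.tendsto[OF B R(3)])
    show "(\<lambda>n. B (diff_quot \<Phi> x (1 / Suc n) 0)) \<longlonglongrightarrow> x"
      unfolding diff_quot_def by (simp add: linear_scale bounded_linear.linear[OF B] Binv)
  qed
  with R show ?thesis by blast
qed

section \<open>The complex free space\<close>

lemma linear_lipschitz_lift_lipfree:
  assumes "separable_space (euclidean :: 'a::banach topology)"
  shows "\<exists>R :: 'a \<Rightarrow> 'a lipfree. linear R \<and> (\<forall>x. norm (R x) \<le> norm x) \<and> (\<forall>x. barycenter (R x) = x)"
  using lipschitz_lifting[OF assms bounded_linear_barycenter lipschitz_delta] by simp

lemma linear_scaleC_right: "linear (\<lambda>x :: 'a::complex_normed_vector. c *\<^sub>C x)"
  by (rule linearI) (simp_all add: scaleC_add_right scaleC_scaleC mult.commute flip: scaleC_of_real)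

lemma bounded_linear_scaleC_right: "bounded_linear (\<lambda>x :: 'a::complex_normed_vector. c *\<^sub>C x)"
  by (rule bounded_linear_intro[where K = "cmod c"])
    (simp_all add: linear_add linear_scale linear_scaleC_right norm_scaleC mult.commute)

lemma scaleC_Re_Im: "c *\<^sub>C x = Re c *\<^sub>R x + Im c *\<^sub>R \<i> *\<^sub>C (x :: 'a::complex_normed_vector)"
proof -
  have "c = of_real (Re c) + of_real (Im c) * \<i>" by (simp add: complex_eq_iff)
  then have "c *\<^sub>C x = (of_real (Re c) + of_real (Im c) * \<i>) *\<^sub>C x" by (rule arg_cong)
  then show ?thesis by (simp only: scaleC_add_left scaleC_scaleC[symmetric] scaleC_of_real)
qed

text \<open>A complex scalar splits into real and imaginary parts, so \<open>\<i>\<close> is the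
  only nonreal scalar to test.\<close>

lemma clinearI:
  fixes f :: "'a::complex_normed_vector \<Rightarrow> 'b::complex_normed_vector"
  assumes "linear f" and i: "\<And>x. f (\<i> *\<^sub>C x) = \<i> *\<^sub>C f x"
  shows "clinear f"
  unfolding Vector_Spaces.linear_iff
proof (intro conjI vector_space_scaleC allI)
  show "f (x + y) = f x + f y" for x y using assms(1) by (rule linear_add)
  show "f (c *\<^sub>C x) = c *\<^sub>C f x" for c x
    using assms(1) by (simp add: scaleC_Re_Im[of c] linear_add linear_scale i)
qed

text \<open>Both sides are bounded and real linear in \<open>u\<close> and agree at every
  \<open>\<delta> x\<close>, so their difference stays in the closed subspace
  \<open>{0}\<close>.\<close>

lemma barycenter_lipfree_dilate:
  "barycenter (lipfree_dilate c u) = c *\<^sub>C (barycenter u :: 'a::complex_banach)"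
proof -
  have "barycenter (lipfree_dilate c u) - c *\<^sub>C barycenter u \<in> {0}"
    by (rule lipfree_induct[where T = "\<lambda>u. barycenter (lipfree_dilate c u) - c *\<^sub>C barycenter u"])
      (auto intro!: bounded_linear_sub bounded_linear_compose[OF bounded_linear_barycenter]
        bounded_linear_lipfree_dilate bounded_linear_compose[OF bounded_linear_scaleC_right]
        bounded_linear_barycenter simp: subspace_def)
  then show ?thesis by simp
qed

text \<open>The barycenter of a generator is \<open>cis \<theta> *\<^sub>C x - cos \<theta>
  *\<^sub>R x - sin \<theta> *\<^sub>R \<i> *\<^sub>C x\<close>, which is \<open>0\<close> by
  complex linearity of the scalar action; the kernel is a closed subspace.\<close>

lemma barycenter_Y_T:
  fixes u :: "'a::complex_banach lipfree"
  assumes "u \<in> Y_T" shows "barycenter u = 0"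
proof -
  let ?G = "{\<delta> (cis \<theta> *\<^sub>C x) - cos \<theta> *\<^sub>R \<delta> x - sin \<theta> *\<^sub>R \<delta> (\<i> *\<^sub>C x) | (x::'a) \<theta>. True}"
  note lin = bounded_linear.linear[OF bounded_linear_barycenter]
  have "?G \<subseteq> barycenter -` {0}"
    by (auto simp: linear_diff[OF lin] linear_scale[OF lin] scaleC_Re_Im[of "cis _"])
  moreover have "subspace (barycenter -` {0 :: 'a})"
    by (rule linear_subspace_vimage[OF lin]) (simp add: subspace_def)
  ultimately have "span ?G \<subseteq> barycenter -` {0}" by (rule span_minimal)
  moreover have "closed (barycenter -` {0 :: 'a})"
    by (intro closed_vimage)
      (auto intro: bounded_linear.continuous_on[OF bounded_linear_barycenter continuous_on_id])
  ultimately have "closure (span ?G) \<subseteq> barycenter -` {0}" by (rule closure_minimal)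
  with assms show ?thesis by (auto simp: Y_T_def)
qed

section \<open>The barycenter map on the quotient\<close>

definition cbarycenter :: "'a::complex_banach clipfree \<Rightarrow> 'a" where
  "cbarycenter w = barycenter (clipfree_rep w)"

lemma clipfree_class_rep [simp]: "clipfree_class (clipfree_rep w) = w"
  by (rule Quotient_abs_rep[OF Quotient_clipfree])

text \<open>The chosen representative differs from \<open>u\<close> by an element of
  \<open>Y_T\<close>, which the barycenter map annihilates.\<close>

lemma cbarycenter_class [simp]: "cbarycenter (clipfree_class u) = barycenter u"
proof -
  have "clipfree_rep (clipfree_class u) - u \<in> Y_T"
    by (rule clipfree.abs_eq_iff[THEN iffD1]) simp
  from barycenter_Y_T[OF this] show ?thesis
    by (simp add: cbarycenter_def linear_diff bounded_linear.linear[OF bounded_linear_barycenter])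
qed

lemma linear_cbarycenter: "linear cbarycenter"
proof (rule linearI)
  fix u v :: "'a clipfree" and r
  note lin = bounded_linear.linear[OF bounded_linear_barycenter]
  have "cbarycenter (clipfree_class a + clipfree_class b)
      = cbarycenter (clipfree_class a) + cbarycenter (clipfree_class b :: 'a clipfree)" for a b
    by (simp add: plus_clipfree.abs_eq linear_add[OF lin])
  from this[of "clipfree_rep u" "clipfree_rep v"]
  show "cbarycenter (u + v) = cbarycenter u + cbarycenter v" by simp
  have "cbarycenter (r *\<^sub>R clipfree_class a) = r *\<^sub>R cbarycenter (clipfree_class a :: 'a clipfree)" for a
    by (simp add: scaleR_clipfree.abs_eq linear_scale[OF lin])
  from this[of "clipfree_rep u"] show "cbarycenter (r *\<^sub>R u) = r *\<^sub>R cbarycenter u" by simp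
qed

lemma clinear_cbarycenter: "clinear cbarycenter"
proof (rule clinearI[OF linear_cbarycenter])
  fix u :: "'a clipfree"
  have "cbarycenter (\<i> *\<^sub>C clipfree_class a) = \<i> *\<^sub>C cbarycenter (clipfree_class a :: 'a clipfree)" for a
    by (simp add: scaleC_clipfree_def clipfree_dilate.abs_eq barycenter_lipfree_dilate)
  from this[of "clipfree_rep u"] show "cbarycenter (\<i> *\<^sub>C u) = \<i> *\<^sub>C cbarycenter u" by simp
qed

text \<open>Every class has lifts of norm arbitrarily close to its quotient norm, and the barycenter
  map is a contraction on lifts.\<close>

lemma norm_cbarycenter_le: "norm (cbarycenter w) \<le> norm w"
proof (rule dense_ge)
  fix r assume "norm w < r"
  then obtain v where "clipfree_class v = w" "norm v < r" using clipfree_lift_norm by blast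
  then show "norm (cbarycenter w) \<le> r" using norm_barycenter_le[of v] by force
qed

theorem proposition21:
  assumes "separable_space (euclidean :: 'a::complex_banach topology)"
  shows "\<exists>T :: 'a \<Rightarrow> 'a clipfree.
    clinear T \<and> (\<forall>x. norm (T x) = norm x) \<and> one_complemented (range T)"
proof -
  obtain R :: "'a \<Rightarrow> 'a lipfree" where R: "linear R" "\<And>x. norm (R x) \<le> norm x" "\<And>x. barycenter (R x) = x"
    using linear_lipschitz_lift_lipfree[OF assms] by blast
  define S where "S x = clipfree_class (R x)" for x
  have S: "linear S"
    using linear_compose[OF R(1) bounded_linear.linear[OF bounded_linear_clipfree_class]]
    by (simp add: S_def[abs_def] o_def)
  have norm_S: "norm (S x) \<le> norm x" for x
    using infdist_Y_T_le[OF subspace_0[OF subspace_Y_T], of "R x"] R(2)[of x]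
    by (simp add: S_def norm_clipfree.abs_eq)
  \<comment> \<open>This is the complex linear part of \<open>S\<close>; the conjugate-linear part
    \<open>(S x + \<i> *\<^sub>C S (\<i> *\<^sub>C x)) /\<^sub>R 2\<close> is discarded.\<close>
  define T where "T x = (S x - \<i> *\<^sub>C S (\<i> *\<^sub>C x)) /\<^sub>R 2" for x
  have ii: "\<i> *\<^sub>C \<i> *\<^sub>C y = - y" for y :: "'c::complex_normed_vector"
    using scaleC_of_real[of "-1" y] by (simp add: scaleC_scaleC)
  have "linear T"
    by (rule linearI)
      (simp_all add: T_def linear_add[OF S] linear_scale[OF S] linear_add[OF linear_scaleC_right]
        linear_scale[OF linear_scaleC_right] algebra_simps)
  moreover have "T (\<i> *\<^sub>C x) = \<i> *\<^sub>C T x" for x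
    by (simp add: T_def ii linear_neg[OF S] linear_neg[OF linear_scaleC_right] scaleC_diff_right
        linear_scale[OF linear_scaleC_right] algebra_simps)
  ultimately have T: "clinear T" by (rule clinearI)
  interpret c: Vector_Spaces.linear scaleC scaleC "cbarycenter :: 'a clipfree \<Rightarrow> 'a"
    by (rule clinear_cbarycenter)
  have cT: "cbarycenter (T x) = x" for x
  proof -
    \<comment> \<open>\<open>cbarycenter\<close> is a left inverse of \<open>S\<close> and commutes
      with \<open>\<i>\<close>, so both terms of \<open>T x\<close> contribute equally.\<close>
    have "cbarycenter (T x) = (x - \<i> *\<^sub>C \<i> *\<^sub>C x) /\<^sub>R 2"
      by (simp add: T_def linear_scale[OF linear_cbarycenter] c.diff c.scale S_def R(3))
    also have "\<dots> = x" by (simp add: ii scaleR_2[symmetric])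
    finally show ?thesis .
  qed
  have norm_T: "norm (T x) = norm x" for x
  proof (rule antisym)
    have "norm (T x) \<le> (norm (S x) + norm (\<i> *\<^sub>C S (\<i> *\<^sub>C x))) / 2"
      using norm_triangle_ineq4[of "S x" "\<i> *\<^sub>C S (\<i> *\<^sub>C x)"] by (simp add: T_def)
    also have "\<dots> \<le> norm x"
      using norm_S[of x] norm_S[of "\<i> *\<^sub>C x"] by (simp add: norm_scaleC)
    finally show "norm (T x) \<le> norm x" .
    show "norm x \<le> norm (T x)" using norm_cbarycenter_le[of "T x"] by (simp add: cT)
  qed
  have "one_complemented (range T)"
    unfolding one_complemented_def
  proof (intro exI[of _ "T \<circ> cbarycenter"] conjI allI)
    show "clinear (T \<circ> cbarycenter)"
      by (rule Vector_Spaces.linear_compose[OF clinear_cbarycenter T])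
    show "(T \<circ> cbarycenter) ((T \<circ> cbarycenter) u) = (T \<circ> cbarycenter) u" for u by (simp add: cT)
    show "norm ((T \<circ> cbarycenter) u) \<le> norm u" for u by (simp add: norm_T norm_cbarycenter_le)
    \<comment> \<open>By \<open>cT\<close> the map \<open>cbarycenter\<close> is surjective, so
      composing with it keeps the range.\<close>
    show "range (T \<circ> cbarycenter) = range T" using cT by (metis fun.set_map surj_def)
  qed
  with T norm_T show ?thesis by blast
qed

end
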